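(* Let $\lambda\in\mathfrak h^*$ with $\lambda(c_1)=k_1\ge 0$ and $\lambda(c_2)=0$. If $\lambda(\alpha_i^\vee)=n_i$ $(i=0,1)$ are nonnegative integers, then $\sum_{i=0}^{1}U(\mathfrak T_-)\,y_i^{n_i+1}v_\lambda$ is a proper submodule of the Verma module $M(\lambda)$ of $\mathfrak T$, where $y_1=f\otimes 1=f(0,0)$ and $y_0=e\otimes t_1^{-1}=e(-1,0)$.
   Context: All over $\mathbb C$; $\mathbb Z_+$ = nonnegative integers, $\mathbb N$ = positive integers. $\mathfrak{sl}_2$ has standard basis $e,f,\alpha^\vee$ with $[e,f]=\alpha^\vee$, $[\alpha^\vee,e]=2e$, $[\alpha^\vee,f]=-2f$ and invariant form with $(e|f)=1$, $(\alpha^\vee|\alpha^\vee)=2$. The toroidal Lie algebra is $\mathfrak T=\mathfrak{sl}_2\otimes\mathbb C[t_1^{\pm1},t_2^{\pm1}]\oplus\mathbb Cc_1\oplus\mathbb Cc_2\oplus\mathbb Cd_1\oplus\mathbb Cd_2$. Writing $x(m,n)=x\otimes t_1^mt_2^n$, the brackets are $[x(r_1,r_2),y(s_1,s_2)]=[x,y](r_1+s_1,r_2+s_2)+(x|y)\delta_{r_1,-s_1}\delta_{r_2,-s_2}(r_1c_1+r_2c_2)$, $c_1,c_2$ central, $[d_i,x(r_1,r_2)]=r_i\,x(r_1,r_2)$, $[d_1,d_2]=0$. Cartan subalgebra: $\mathfrak h=\mathbb C\alpha^\vee\oplus\mathbb Cc_1\oplus\mathbb Cc_2\oplus\mathbb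 Cd_1\oplus\mathbb Cd_2$ ($\alpha^\vee=\alpha^\vee(0,0)$). Coroots: $\alpha_1^\vee=\alpha^\vee$, $\alpha_0^\vee=c_1-\alpha^\vee$. Triangular decomposition $\mathfrak T=\mathfrak T_+\oplus\mathfrak h\oplus\mathfrak T_-$: $\mathfrak T_+$ is spanned by $e(m,0)$ $(m\ge 0)$, $f(m,0)$ and $\alpha^\vee(m,0)$ $(m\ge1)$, and all $x(m,n)$ with $x\in\mathfrak{sl}_2$, $m\in\mathbb Z$, $n\ge1$; $\mathfrak T_-$ is spanned by $f(-m,0)$ $(m\ge0)$, $e(-m,0)$ and $\alpha^\vee(-m,0)$ $(m\ge1)$, and all $x(m,-n)$ with $x\in\mathfrak{sl}_2$, $m\in\mathbb Z$, $n\ge1$. Verma module: $M(\lambda)=U(\mathfrak T)\otimes_{U(\mathfrak T_+\oplus\mathfrak h)}\mathbb C1_\lambda$, where $\mathfrak T_+$ acts by $0$ on $1_\lambda$ and $h\in\mathfrak h$ acts by $\lambda(h)$; $v_\lambda=1\otimes1_\lambda$. *)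

theory Defs
  imports
    Complex_Main
    "HOL-Library.Poly_Mapping"
    "HOL-Library.Product_Plus"
    "HOL-Algebra.Free_Abelian_Groups"
    "HOL-Algebra.AbelCoset"
    "HOL-Algebra.Module"
begin

section \<open>Complex vector spaces, algebras and Lie algebras\<close>

class complex_vector = ab_group_add +
  fixes scaleC :: "complex \<Rightarrow> 'a \<Rightarrow> 'a" (infixr \<open>*\<^sub>C\<close> 75)
  assumes scaleC_add_right: "a *\<^sub>C (x + y) = a *\<^sub>C x + a *\<^sub>C y"
    and scaleC_add_left: "(a + b) *\<^sub>C x = a *\<^sub>C x + b *\<^sub>C x"
    and scaleC_scaleC: "a *\<^sub>C (b *\<^sub>C x) = (a * b) *\<^sub>C x"
    and scaleC_one: "1 *\<^sub>C x = x"

global_interpretation complex_vector: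
  vector_space "scaleC :: complex \<Rightarrow> 'a \<Rightarrow> 'a::complex_vector"
  by unfold_locales (simp_all add: scaleC_add_right scaleC_add_left scaleC_scaleC scaleC_one)

class complex_algebra_1 = complex_vector + ring_1 +
  assumes mult_scaleC_left: "(a *\<^sub>C x) * y = a *\<^sub>C (x * y)"
    and mult_scaleC_right: "x * (a *\<^sub>C y) = a *\<^sub>C (x * y)"

class complex_lie_algebra = complex_vector +
  fixes lie :: "'a \<Rightarrow> 'a \<Rightarrow> 'a"
  assumes lie_add_left: "lie (x + y) z = lie x z + lie y z"
    and lie_add_right: "lie x (y + z) = lie x y + lie x z"
    and lie_scaleC_left: "lie (a *\<^sub>C x) y = a *\<^sub>C lie x y"
    and lie_scaleC_right: "lie x (a *\<^sub>C y) = a *\<^sub>C lie x y"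
    and lie_self: "lie x x = 0"
    and lie_jacobi: "lie x (lie y z) + lie y (lie z x) + lie z (lie x y) = 0"
begin

lemma lie_zero_left [simp]: "lie 0 x = 0"
  using lie_add_left[of 0 0 x] by simp

lemma lie_zero_right [simp]: "lie x 0 = 0"
  using lie_add_right[of x 0 0] by simp

lemma lie_skew: "lie x y = - lie y x"
proof -
  have "0 = lie (x + y) (x + y)"
    by (simp only: lie_self)
  also have "\<dots> = lie x y + lie y x"
    unfolding lie_add_left lie_add_right by (simp add: lie_self add.commute)
  finally show ?thesis
    by (simp add: eq_neg_iff_add_eq_0)
qed

end

instantiation complex :: complex_algebra_1
begin

definition scaleC_complex :: "complex \<Rightarrow> complex \<Rightarrow> complex" where
  "scaleC_complex a x = a * x"

instance
  by standard (simp_all add: scaleC_complex_def algebra_simps)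

end

text \<open>The map on finitely supported functions that sends \<open>single r x\<close> to \<open>f r x\<close> and is
  additive whenever every \<open>f r\<close> is.\<close>

definition pm_extend :: "('r \<Rightarrow> 'a::zero \<Rightarrow> 'b::comm_monoid_add) \<Rightarrow> ('r \<Rightarrow>\<^sub>0 'a) \<Rightarrow> 'b" where
  "pm_extend f X = (\<Sum>r\<in>Poly_Mapping.keys X. f r (Poly_Mapping.lookup X r))"

lemma pm_extend_zero [simp]: "pm_extend f 0 = 0"
  by (simp add: pm_extend_def)

lemma pm_extend_single: "f r 0 = 0 \<Longrightarrow> pm_extend f (Poly_Mapping.single r x) = f r x"
  by (simp add: pm_extend_def)

lemma pm_extend_add:
  assumes "\<And>r. f r 0 = 0" "\<And>r x y. f r (x + y) = f r x + f r y"
  shows "pm_extend f (X + Y) = pm_extend f X + pm_extend f Y"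
  unfolding pm_extend_def by (rule setsum_keys_plus_distrib) (simp_all add: assms)

lemma pm_extend_plus_fun:
  "pm_extend (\<lambda>r x. f r x + g r x) X = pm_extend f X + pm_extend g X"
  by (simp add: pm_extend_def sum.distrib)

lemma pm_extend_zero_fun [simp]: "pm_extend (\<lambda>r x. 0) X = 0"
  by (simp add: pm_extend_def)

lemma pm_induct [case_names zero single add]:
  fixes X :: "'r \<Rightarrow>\<^sub>0 'a::monoid_add"
  assumes "P 0" "\<And>r x. P (Poly_Mapping.single r x)" "\<And>X Y. P X \<Longrightarrow> P Y \<Longrightarrow> P (X + Y)"
  shows "P X"
proof (induction X rule: update_induct)
  case const
  show ?case by (rule assms(1))
next
  case (update f a b)
  have "Poly_Mapping.update a b f = f + Poly_Mapping.single a b"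
    using update(1)
    by (intro poly_mapping_eqI) (auto simp: lookup_update lookup_add lookup_single in_keys_iff)
  then show ?case
    using assms update by simp
qed

instantiation poly_mapping :: (type, complex_vector) complex_vector
begin

definition scaleC_poly_mapping :: "complex \<Rightarrow> ('a \<Rightarrow>\<^sub>0 'b) \<Rightarrow> 'a \<Rightarrow>\<^sub>0 'b" where
  "scaleC_poly_mapping a = Poly_Mapping.map (scaleC a)"

lemma lookup_scaleC [simp]:
  "Poly_Mapping.lookup (a *\<^sub>C X) r = a *\<^sub>C Poly_Mapping.lookup (X :: 'a \<Rightarrow>\<^sub>0 'b) r"
  unfolding scaleC_poly_mapping_def by (simp add: map.rep_eq when_def)

instance
  by standard (auto intro!: poly_mapping_eqI
      simp: lookup_add scaleC_add_right scaleC_add_left scaleC_scaleC scaleC_one)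

end

lemma scaleC_single [simp]:
  "a *\<^sub>C Poly_Mapping.single r x = Poly_Mapping.single r (a *\<^sub>C x :: 'a::complex_vector)"
  by (rule poly_mapping_eqI) (auto simp: lookup_single when_def)

section \<open>The toroidal Lie algebra of \<open>sl\<^sub>2\<close>\<close>

text \<open>\<open>Sl2 a b c\<close> stands for \<open>a e + b f + c \<alpha>\<^sup>\<or>\<close>.\<close>

datatype sl2 = Sl2 (e_coeff: complex) (f_coeff: complex) (h_coeff: complex)

lemma sl2_eq_iff:
  "x = y \<longleftrightarrow> e_coeff x = e_coeff y \<and> f_coeff x = f_coeff y \<and> h_coeff x = h_coeff y"
  by (cases x; cases y) simp

instantiation sl2 :: complex_lie_algebra
begin

definition "0 = Sl2 0 0 0"

definition "x + y = Sl2 (e_coeff x + e_coeff y) (f_coeff x + f_coeff y) (h_coeff x + h_coeff y)"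

definition "- x = Sl2 (- e_coeff x) (- f_coeff x) (- h_coeff x)"

definition "x - y = Sl2 (e_coeff x - e_coeff y) (f_coeff x - f_coeff y) (h_coeff x - h_coeff y)"

definition "a *\<^sub>C x = Sl2 (a * e_coeff x) (a * f_coeff x) (a * h_coeff x)"

definition "lie x y = Sl2
  (2 * (h_coeff x * e_coeff y - e_coeff x * h_coeff y))
  (2 * (f_coeff x * h_coeff y - h_coeff x * f_coeff y))
  (e_coeff x * f_coeff y - f_coeff x * e_coeff y)"

lemmas sl2_defs = zero_sl2_def plus_sl2_def uminus_sl2_def minus_sl2_def scaleC_sl2_def lie_sl2_def

instance
  by standard (simp_all add: sl2_defs sl2_eq_iff algebra_simps)

end

definition sl2_e :: sl2 where "sl2_e = Sl2 1 0 0"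
definition sl2_f :: sl2 where "sl2_f = Sl2 0 1 0"
definition sl2_h :: sl2 where "sl2_h = Sl2 0 0 1"

definition sl2_form :: "sl2 \<Rightarrow> sl2 \<Rightarrow> complex" where
  "sl2_form x y = e_coeff x * f_coeff y + f_coeff x * e_coeff y + 2 * (h_coeff x * h_coeff y)"

lemma sl2_brackets:
  "lie sl2_e sl2_f = sl2_h" "lie sl2_h sl2_e = 2 *\<^sub>C sl2_e" "lie sl2_h sl2_f = (- 2) *\<^sub>C sl2_f"
  by (simp_all add: sl2_e_def sl2_f_def sl2_h_def sl2_defs)

lemma sl2_form_values: "sl2_form sl2_e sl2_f = 1" "sl2_form sl2_h sl2_h = 2"
  by (simp_all add: sl2_e_def sl2_f_def sl2_h_def sl2_form_def)

lemma sl2_form_sym: "sl2_form x y = sl2_form y x"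
  by (simp add: sl2_form_def algebra_simps)

lemma sl2_form_invariant: "sl2_form (lie x y) z = sl2_form x (lie y z)"
  by (simp add: sl2_form_def sl2_defs algebra_simps)

lemma sl2_form_linear [simp]:
  "sl2_form 0 y = 0" "sl2_form x 0 = 0"
  "sl2_form (x + x') y = sl2_form x y + sl2_form x' y"
  "sl2_form x (y + y') = sl2_form x y + sl2_form x y'"
  "sl2_form (a *\<^sub>C x) y = a * sl2_form x y"
  "sl2_form x (a *\<^sub>C y) = a * sl2_form x y"
  by (simp_all add: sl2_form_def sl2_defs algebra_simps)

text \<open>The component \<open>sl\<^sub>2 \<otimes> \<complex>[t\<^sub>1\<^sup>\<plusminus>\<^sup>1, t\<^sub>2\<^sup>\<plusminus>\<^sup>1]\<close> is the space of finitely supported functions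
  \<open>\<int>\<^sup>2 \<rightarrow> sl\<^sub>2\<close>; \<open>x \<otimes> t\<^sub>1\<^sup>m t\<^sub>2\<^sup>n\<close> is \<open>single (m, n) x\<close>.\<close>

datatype toroidal = Toroidal
  (loop: "int \<times> int \<Rightarrow>\<^sub>0 sl2")
  (c1_coeff: complex) (c2_coeff: complex) (d1_coeff: complex) (d2_coeff: complex)

lemma toroidal_eq_iff:
  "x = y \<longleftrightarrow> loop x = loop y \<and> c1_coeff x = c1_coeff y \<and> c2_coeff x = c2_coeff y
    \<and> d1_coeff x = d1_coeff y \<and> d2_coeff x = d2_coeff y"
  by (cases x; cases y) simp

definition loop_lie :: "(int \<times> int \<Rightarrow>\<^sub>0 sl2) \<Rightarrow> (int \<times> int \<Rightarrow>\<^sub>0 sl2) \<Rightarrow> (int \<times> int \<Rightarrow>\<^sub>0 sl2)" where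
  "loop_lie X Y =
     pm_extend (\<lambda>r x. pm_extend (\<lambda>s y. Poly_Mapping.single (r + s) (lie x y)) Y) X"

text \<open>The coefficient of \<open>c\<^sub>1\<close> (for \<open>p = fst\<close>) or \<open>c\<^sub>2\<close> (for \<open>p = snd\<close>) in a bracket of loops.\<close>

definition loop_cocycle ::
    "(int \<times> int \<Rightarrow> int) \<Rightarrow> (int \<times> int \<Rightarrow>\<^sub>0 sl2) \<Rightarrow> (int \<times> int \<Rightarrow>\<^sub>0 sl2) \<Rightarrow> complex" where
  "loop_cocycle p X Y =
     pm_extend (\<lambda>r x. of_int (p r) * sl2_form x (Poly_Mapping.lookup Y (- r))) X"

text \<open>The adjoint action of \<open>a d\<^sub>1 + b d\<^sub>2\<close> on loops.\<close>

definition loop_deriv :: "complex \<Rightarrow> complex \<Rightarrow> (int \<times> int \<Rightarrow>\<^sub>0 sl2) \<Rightarrow> (int \<times> int \<Rightarrow>\<^sub>0 sl2)" where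
  "loop_deriv a b X =
     pm_extend (\<lambda>r x. Poly_Mapping.single r ((a * of_int (fst r) + b * of_int (snd r)) *\<^sub>C x)) X"

lemma loop_lie_zero [simp]: "loop_lie 0 Y = 0" "loop_lie X 0 = 0"
  by (simp_all add: loop_lie_def)

lemma loop_lie_add_left: "loop_lie (X + X') Y = loop_lie X Y + loop_lie X' Y"
  unfolding loop_lie_def
  by (rule pm_extend_add) (simp_all add: lie_add_left single_add pm_extend_plus_fun)

lemma loop_lie_add_right: "loop_lie X (Y + Y') = loop_lie X Y + loop_lie X Y'"
  unfolding loop_lie_def pm_extend_plus_fun[symmetric]
  by (subst pm_extend_add) (simp_all add: lie_add_right single_add)

lemma loop_lie_single [simp]:
  "loop_lie (Poly_Mapping.single r x) (Poly_Mapping.single s y) = Poly_Mapping.single (r + s) (lie x y)"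
  by (simp add: loop_lie_def pm_extend_single)

lemma loop_cocycle_zero [simp]: "loop_cocycle p 0 Y = 0" "loop_cocycle p X 0 = 0"
  by (simp_all add: loop_cocycle_def)

lemma loop_cocycle_add_left: "loop_cocycle p (X + X') Y = loop_cocycle p X Y + loop_cocycle p X' Y"
  unfolding loop_cocycle_def by (rule pm_extend_add) (simp_all add: algebra_simps)

lemma loop_cocycle_add_right: "loop_cocycle p X (Y + Y') = loop_cocycle p X Y + loop_cocycle p X Y'"
  unfolding loop_cocycle_def pm_extend_plus_fun[symmetric] by (simp add: lookup_add algebra_simps)

lemma loop_cocycle_single [simp]:
  "loop_cocycle p (Poly_Mapping.single r x) (Poly_Mapping.single s y) =
     (if s = - r then of_int (p r) * sl2_form x y else 0)"
  by (auto simp add: loop_cocycle_def pm_extend_single lookup_single when_def)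

lemma loop_deriv_zero [simp]: "loop_deriv a b 0 = 0" "loop_deriv 0 0 X = 0"
  by (simp_all add: loop_deriv_def)

lemma loop_deriv_add_right: "loop_deriv a b (X + Y) = loop_deriv a b X + loop_deriv a b Y"
  unfolding loop_deriv_def
  by (rule pm_extend_add) (simp_all add: scaleC_add_right single_add)

lemma loop_deriv_add_left: "loop_deriv (a + a') (b + b') X = loop_deriv a b X + loop_deriv a' b' X"
proof (induction X rule: pm_induct)
  case (single r x)
  then show ?case
    by (simp add: loop_deriv_def pm_extend_single single_add
        scaleC_add_left algebra_simps)
qed (simp_all add: loop_deriv_add_right algebra_simps)

lemma loop_deriv_single [simp]:
  "loop_deriv a b (Poly_Mapping.single r x) =
     Poly_Mapping.single r ((a * of_int (fst r) + b * of_int (snd r)) *\<^sub>C x)"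
  by (simp add: loop_deriv_def pm_extend_single)

lemma loop_lie_scaleC_left: "loop_lie (a *\<^sub>C X) Y = a *\<^sub>C loop_lie X Y"
proof (induction X rule: pm_induct)
  case (single r x)
  show ?case
    by (induction Y rule: pm_induct) (simp_all add: loop_lie_add_right scaleC_add_right lie_scaleC_left)
qed (simp_all add: loop_lie_add_left scaleC_add_right)

lemma loop_lie_skew: "loop_lie X Y = - loop_lie Y X"
proof (induction X rule: pm_induct)
  case (single r x)
  show ?case
  proof (induction Y rule: pm_induct)
    case (single s y)
    show ?case
      by (metis loop_lie_single add.commute lie_skew single_uminus)
  qed (simp_all add: loop_lie_add_right loop_lie_add_left)
qed (simp_all add: loop_lie_add_left loop_lie_add_right)

lemma loop_cocycle_scaleC_left: "loop_cocycle p (a *\<^sub>C X) Y = a * loop_cocycle p X Y"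
proof (induction X rule: pm_induct)
  case (single r x)
  show ?case
    by (induction Y rule: pm_induct) (simp_all add: loop_cocycle_add_right algebra_simps)
qed (simp_all add: loop_cocycle_add_left scaleC_add_right algebra_simps)

lemma loop_cocycle_skew:
  assumes "\<And>r. p (- r) = - p r"
  shows "loop_cocycle p X Y = - loop_cocycle p Y X"
proof (induction X rule: pm_induct)
  case (single r x)
  show ?case
    by (induction Y rule: pm_induct)
      (auto simp: loop_cocycle_add_right loop_cocycle_add_left sl2_form_sym assms)
qed (simp_all add: loop_cocycle_add_left loop_cocycle_add_right)

lemma loop_deriv_scaleC:
  "loop_deriv (c * a) (c * b) X = c *\<^sub>C loop_deriv a b X"
  "loop_deriv a b (c *\<^sub>C X) = c *\<^sub>C loop_deriv a b X"
proof -
  show "loop_deriv (c * a) (c * b) X = c *\<^sub>C loop_deriv a b X"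
    by (induction X rule: pm_induct)
      (simp_all add: loop_deriv_add_right scaleC_add_right scaleC_scaleC algebra_simps)
  show "loop_deriv a b (c *\<^sub>C X) = c *\<^sub>C loop_deriv a b X"
    by (induction X rule: pm_induct)
      (simp_all add: loop_deriv_add_right scaleC_add_right scaleC_scaleC algebra_simps)
qed

lemma loop_lie_diff_right: "loop_lie X (Y - Y') = loop_lie X Y - loop_lie X Y'"
  by (metis add_diff_cancel diff_add_cancel loop_lie_add_right)

lemma loop_cocycle_diff_right: "loop_cocycle p X (Y - Y') = loop_cocycle p X Y - loop_cocycle p X Y'"
  by (metis add_diff_cancel diff_add_cancel loop_cocycle_add_right)

lemma loop_deriv_diff_right: "loop_deriv a b (X - Y) = loop_deriv a b X - loop_deriv a b Y"
  by (metis add_diff_cancel diff_add_cancel loop_deriv_add_right)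

lemma loop_lie_jacobi: "loop_lie X (loop_lie Y Z) + loop_lie Y (loop_lie Z X) + loop_lie Z (loop_lie X Y) = 0"
proof (induction X rule: pm_induct)
  case (single r x)
  show ?case
  proof (induction Y rule: pm_induct)
    case (single s y)
    show ?case
    proof (induction Z rule: pm_induct)
      case (single t z)
      show ?case
        using lie_jacobi[of x y z] by (simp add: ac_simps single_add[symmetric])
    qed (simp_all add: loop_lie_add_left loop_lie_add_right algebra_simps add_eq_0_iff)
  qed (simp_all add: loop_lie_add_left loop_lie_add_right algebra_simps add_eq_0_iff)
qed (simp_all add: loop_lie_add_left loop_lie_add_right algebra_simps add_eq_0_iff)

lemma loop_deriv_lie:
  "loop_deriv a b (loop_lie X Y) = loop_lie (loop_deriv a b X) Y + loop_lie X (loop_deriv a b Y)"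
proof (induction X rule: pm_induct)
  case (single r x)
  show ?case
  proof (induction Y rule: pm_induct)
    case (single s y)
    show ?case
      by (simp add: lie_scaleC_left lie_scaleC_right single_add scaleC_add_left
          loop_lie_add_left loop_lie_add_right algebra_simps)
  qed (simp_all add: loop_lie_add_right loop_deriv_add_right)
qed (simp_all add: loop_lie_add_left loop_deriv_add_right)

lemma loop_deriv_commute:
  "loop_deriv a b (loop_deriv a' b' X) = loop_deriv a' b' (loop_deriv a b X)"
  by (induction X rule: pm_induct) (simp_all add: loop_deriv_add_right scaleC_scaleC mult.commute)

lemma loop_cocycle_deriv:
  assumes "\<And>r. p (- r) = - p r"
  shows "loop_cocycle p X (loop_deriv a b Y) = loop_cocycle p Y (loop_deriv a b X)"
proof (induction X rule: pm_induct)
  case (single r x)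
  show ?case
  proof (induction Y rule: pm_induct)
    case (single s y)
    show ?case
      by (auto simp: assms sl2_form_sym algebra_simps)
  qed (simp_all add: loop_cocycle_add_left loop_cocycle_add_right loop_deriv_add_right)
qed (simp_all add: loop_cocycle_add_left loop_cocycle_add_right loop_deriv_add_right)

lemma loop_cocycle_jacobi:
  assumes "\<And>r s. p (r + s) = p r + p s" "\<And>r. p (- r) = - p r"
  shows "loop_cocycle p X (loop_lie Y Z) + loop_cocycle p Y (loop_lie Z X)
    + loop_cocycle p Z (loop_lie X Y) = 0"
proof (induction X rule: pm_induct)
  case (single r x)
  show ?case
  proof (induction Y rule: pm_induct)
    case (single s y)
    show ?case
    proof (induction Z rule: pm_induct)
      case (single t z)
      have inv: "sl2_form y (lie z x) = sl2_form x (lie y z)" "sl2_form z (lie x y) = sl2_form x (lie y z)"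
        by (simp_all add: sl2_form_def lie_sl2_def algebra_simps)
      have iff: "s + t = - r \<longleftrightarrow> t = - r - s" "t + r = - s \<longleftrightarrow> t = - r - s" "r + s = - t \<longleftrightarrow> t = - r - s"
        by (auto simp: prod_eq_iff)
      show ?case
      proof (cases "t = - r - s")
        case True
        have "p t = - p r - p s"
          using assms(1)[of "- r" "- s"] True by (simp add: assms(2))
        then show ?thesis
          unfolding loop_lie_single loop_cocycle_single iff inv using True by (simp add: left_diff_distrib)
      next
        case False
        then show ?thesis
          unfolding loop_lie_single loop_cocycle_single iff by simp
      qed
    qed (simp_all add: loop_lie_add_left loop_lie_add_right loop_cocycle_add_left
        loop_cocycle_add_right algebra_simps add_eq_0_iff)
  qed (simp_all add: loop_lie_add_left loop_lie_add_right loop_cocycle_add_left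
      loop_cocycle_add_right algebra_simps add_eq_0_iff)
qed (simp_all add: loop_lie_add_left loop_lie_add_right loop_cocycle_add_left
    loop_cocycle_add_right algebra_simps add_eq_0_iff)

instantiation toroidal :: complex_vector
begin

definition "0 = Toroidal 0 0 0 0 0"

definition "x + y = Toroidal (loop x + loop y) (c1_coeff x + c1_coeff y) (c2_coeff x + c2_coeff y)
  (d1_coeff x + d1_coeff y) (d2_coeff x + d2_coeff y)"

definition "- x = Toroidal (- loop x) (- c1_coeff x) (- c2_coeff x) (- d1_coeff x) (- d2_coeff x)"

definition "x - y = Toroidal (loop x - loop y) (c1_coeff x - c1_coeff y) (c2_coeff x - c2_coeff y)
  (d1_coeff x - d1_coeff y) (d2_coeff x - d2_coeff y)"

definition "a *\<^sub>C x = Toroidal (a *\<^sub>C loop x) (a * c1_coeff x) (a * c2_coeff x)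
  (a * d1_coeff x) (a * d2_coeff x)"

lemmas toroidal_defs =
  zero_toroidal_def plus_toroidal_def uminus_toroidal_def minus_toroidal_def scaleC_toroidal_def

instance
  by standard (simp_all add: toroidal_defs toroidal_eq_iff algebra_simps
      scaleC_add_right scaleC_add_left scaleC_scaleC scaleC_one)

end

instantiation toroidal :: complex_lie_algebra
begin

definition "lie x y = Toroidal
  (loop_lie (loop x) (loop y) + loop_deriv (d1_coeff x) (d2_coeff x) (loop y)
    - loop_deriv (d1_coeff y) (d2_coeff y) (loop x))
  (loop_cocycle fst (loop x) (loop y))
  (loop_cocycle snd (loop x) (loop y))
  0 0"

instance
proof
  fix x y z :: toroidal and a :: complex
  show l: "lie (x + y) z = lie x z + lie y z" for x y z :: toroidal
    by (simp add: lie_toroidal_def toroidal_defs loop_lie_add_left loop_cocycle_add_left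
        loop_deriv_add_left loop_deriv_add_right)
  show sc: "lie (a *\<^sub>C x) y = a *\<^sub>C lie x y" for x y :: toroidal
    by (simp add: lie_toroidal_def toroidal_defs loop_lie_scaleC_left loop_cocycle_scaleC_left
        loop_deriv_scaleC complex_vector.scale_right_diff_distrib scaleC_add_right)
  have skew: "lie x y = - lie y x" for x y :: toroidal
    using loop_lie_skew[of "loop x" "loop y"] loop_cocycle_skew[of fst "loop x" "loop y"]
      loop_cocycle_skew[of snd "loop x" "loop y"]
    by (simp add: lie_toroidal_def toroidal_defs)
  show r: "lie x (y + z) = lie x y + lie x z" for x y z :: toroidal
    using skew[of x "y + z"] skew[of x y] skew[of x z] l[of y z x] by simp
  show "lie x (a *\<^sub>C y) = a *\<^sub>C lie x y"
    using skew[of x "a *\<^sub>C y"] skew[of x y] sc[of y x] by simp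
  show "lie x x = 0"
  proof -
    have neg: "u = 0" if "u = - u" for u :: toroidal
    proof -
      have "(1/2) *\<^sub>C (u + u) = u"
        by (simp add: scaleC_add_right scaleC_add_left[symmetric] scaleC_one)
      moreover have "u + u = 0"
        using that by (metis add.right_inverse)
      ultimately show ?thesis
        by simp
    qed
    show ?thesis
      by (rule neg, rule skew)
  qed
  have zero: "lie 0 x = 0" "lie x 0 = 0" for x :: toroidal
    using l[of 0 0 x] r[of x 0 0] by simp_all
  have "loop (lie x (lie y z) + lie y (lie z x) + lie z (lie x y)) = 0"
    using loop_lie_jacobi[of "loop x" "loop y" "loop z"]
      loop_lie_skew[of "loop_deriv (d1_coeff x) (d2_coeff x) (loop y)" "loop z"]
      loop_lie_skew[of "loop_deriv (d1_coeff y) (d2_coeff y) (loop z)" "loop x"]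
      loop_lie_skew[of "loop_deriv (d1_coeff z) (d2_coeff z) (loop x)" "loop y"]
      loop_deriv_commute[of "d1_coeff x" "d2_coeff x" "d1_coeff y" "d2_coeff y" "loop z"]
      loop_deriv_commute[of "d1_coeff y" "d2_coeff y" "d1_coeff z" "d2_coeff z" "loop x"]
      loop_deriv_commute[of "d1_coeff z" "d2_coeff z" "d1_coeff x" "d2_coeff x" "loop y"]
    by (simp add: lie_toroidal_def toroidal_defs loop_lie_add_right loop_lie_diff_right
        loop_deriv_add_right loop_deriv_diff_right loop_deriv_lie algebra_simps)
  moreover have "loop_cocycle p (loop x) (loop (lie y z)) + loop_cocycle p (loop y) (loop (lie z x))
      + loop_cocycle p (loop z) (loop (lie x y)) = 0"
    if p: "p = fst \<or> p = snd" for p :: "int \<times> int \<Rightarrow> int"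
  proof -
    have add: "p (r + s) = p r + p s" "p (- r) = - p r" for r s
      using p by auto
    show ?thesis
      using loop_cocycle_jacobi[of p "loop x" "loop y" "loop z", OF add]
        loop_cocycle_deriv[of p "loop y" "d1_coeff x" "d2_coeff x" "loop z", OF add(2)]
        loop_cocycle_deriv[of p "loop z" "d1_coeff y" "d2_coeff y" "loop x", OF add(2)]
        loop_cocycle_deriv[of p "loop x" "d1_coeff z" "d2_coeff z" "loop y", OF add(2)]
      by (simp add: lie_toroidal_def toroidal_defs loop_cocycle_add_right loop_cocycle_diff_right add.assoc)
  qed
  from this[of fst] this[of snd] have
    "c1_coeff (lie x (lie y z) + lie y (lie z x) + lie z (lie x y)) = 0"
    "c2_coeff (lie x (lie y z) + lie y (lie z x) + lie z (lie x y)) = 0"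
    by (simp_all add: lie_toroidal_def toroidal_defs)
  ultimately show "lie x (lie y z) + lie y (lie z x) + lie z (lie x y) = 0"
    by (simp add: toroidal_eq_iff) (simp add: lie_toroidal_def toroidal_defs)
qed

end


definition loop_el :: "sl2 \<Rightarrow> int \<Rightarrow> int \<Rightarrow> toroidal" where
  "loop_el x m n = Toroidal (Poly_Mapping.single (m, n) x) 0 0 0 0"

definition tor_c1 :: toroidal where "tor_c1 = Toroidal 0 1 0 0 0"
definition tor_c2 :: toroidal where "tor_c2 = Toroidal 0 0 1 0 0"
definition tor_d1 :: toroidal where "tor_d1 = Toroidal 0 0 0 1 0"
definition tor_d2 :: toroidal where "tor_d2 = Toroidal 0 0 0 0 1"

lemmas tor_basis_defs = loop_el_def tor_c1_def tor_c2_def tor_d1_def tor_d2_def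

lemma toroidal_brackets:
  "lie (loop_el x r1 r2) (loop_el y s1 s2) = loop_el (lie x y) (r1 + s1) (r2 + s2)
     + (if r1 = - s1 \<and> r2 = - s2
        then sl2_form x y *\<^sub>C (of_int r1 *\<^sub>C tor_c1 + of_int r2 *\<^sub>C tor_c2) else 0)"
  "lie tor_c1 z = 0" "lie tor_c2 z = 0"
  "lie tor_d1 (loop_el x r1 r2) = of_int r1 *\<^sub>C loop_el x r1 r2"
  "lie tor_d2 (loop_el x r1 r2) = of_int r2 *\<^sub>C loop_el x r1 r2"
  "lie tor_d1 tor_d2 = 0"
  by (auto simp: lie_toroidal_def tor_basis_defs toroidal_defs toroidal_eq_iff)

section \<open>Triangular decomposition\<close>

definition cartan :: "toroidal set" where
  "cartan = complex_vector.span {loop_el sl2_h 0 0, tor_c1, tor_c2, tor_d1, tor_d2}"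

definition positive_part :: "toroidal set" where
  "positive_part = complex_vector.span
     ({loop_el sl2_e m 0 |m. m \<ge> 0} \<union> {loop_el sl2_f m 0 |m. m \<ge> 1}
      \<union> {loop_el sl2_h m 0 |m. m \<ge> 1} \<union> {loop_el x m n |x m n. n \<ge> 1})"

definition negative_part :: "toroidal set" where
  "negative_part = complex_vector.span
     ({loop_el sl2_f (- m) 0 |m. m \<ge> 0} \<union> {loop_el sl2_e (- m) 0 |m. m \<ge> 1}
      \<union> {loop_el sl2_h (- m) 0 |m. m \<ge> 1} \<union> {loop_el x m (- n) |x m n. n \<ge> 1})"

definition borel_part :: "toroidal set" where
  "borel_part = {x + h |x h. x \<in> positive_part \<and> h \<in> cartan}"

lemma loop_expansion:
  "Toroidal X 0 0 0 0 = (\<Sum>r\<in>Poly_Mapping.keys X. loop_el (Poly_Mapping.lookup X r) (fst r) (snd r))"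
proof -
  have *: "(\<Sum>r\<in>A. Toroidal (Y r) 0 0 0 0) = Toroidal (sum Y A) 0 0 0 0"
    for A :: "(int \<times> int) set" and Y
    by (induction A rule: infinite_finite_induct) (simp_all add: toroidal_defs)
  have "X = (\<Sum>r\<in>Poly_Mapping.keys X. Poly_Mapping.single r (Poly_Mapping.lookup X r))"
    by (rule poly_mapping_eqI) (auto simp: lookup_sum lookup_single when_def in_keys_iff)
  then show ?thesis
    by (simp add: loop_el_def *)
qed

lemma loop_el_expansion:
  "loop_el y m n = e_coeff y *\<^sub>C loop_el sl2_e m n + f_coeff y *\<^sub>C loop_el sl2_f m n
    + h_coeff y *\<^sub>C loop_el sl2_h m n"
  by (simp add: loop_el_def toroidal_defs single_add[symmetric])
    (simp add: sl2_e_def sl2_f_def sl2_h_def sl2_defs)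

lemma sl2_zero_coeff [simp]: "e_coeff 0 = 0" "f_coeff 0 = 0" "h_coeff 0 = 0"
  by (simp_all add: zero_sl2_def)

lemma f_coeff_linear:
  "f_coeff (x + y) = f_coeff x + f_coeff y" "f_coeff (x - y) = f_coeff x - f_coeff y"
  "f_coeff (a *\<^sub>C x) = a * f_coeff x"
  by (simp_all add: sl2_defs)

lemma positive_part_iff:
  "x \<in> positive_part \<longleftrightarrow>
     c1_coeff x = 0 \<and> c2_coeff x = 0 \<and> d1_coeff x = 0 \<and> d2_coeff x = 0
     \<and> (\<forall>m n. n < 0 \<or> n = 0 \<and> m < 0 \<longrightarrow> Poly_Mapping.lookup (loop x) (m, n) = 0)
     \<and> f_coeff (Poly_Mapping.lookup (loop x) (0, 0)) = 0
     \<and> h_coeff (Poly_Mapping.lookup (loop x) (0, 0)) = 0" (is "_ = ?P x")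
proof
  have "positive_part \<subseteq> Collect ?P"
    unfolding positive_part_def
  proof (rule complex_vector.span_minimal)
    show "complex_vector.subspace (Collect ?P)"
      by (auto simp: complex_vector.subspace_def toroidal_defs lookup_add sl2_defs)
  qed (auto simp: loop_el_def lookup_single when_def sl2_e_def sl2_f_def sl2_h_def)
  then show "x \<in> positive_part \<Longrightarrow> ?P x"
    by blast
next
  assume P: "?P x"
  note closed = complex_vector.subspace_add complex_vector.subspace_scale
  have sub: "complex_vector.subspace positive_part"
    by (simp add: positive_part_def)
  have e: "loop_el sl2_e m 0 \<in> positive_part" if "m \<ge> 0" for m
    unfolding positive_part_def using that by (intro complex_vector.span_base) blast
  have f: "loop_el sl2_f m 0 \<in> positive_part" "loop_el sl2_h m 0 \<in> positive_part" if "m \<ge> 1" for m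
    unfolding positive_part_def using that by (intro complex_vector.span_base; blast)+
  have x: "loop_el x m n \<in> positive_part" if "n \<ge> 1" for x m n
    unfolding positive_part_def using that by (intro complex_vector.span_base) blast
  have el: "loop_el y m n \<in> positive_part"
    if "n \<ge> 1 \<or> n = 0 \<and> m \<ge> 1 \<or> n = 0 \<and> m = 0 \<and> f_coeff y = 0 \<and> h_coeff y = 0" for y m n
    using that
  proof (elim disjE conjE)
    assume "n = 0" "m \<ge> 1"
    then show ?thesis
      by (subst loop_el_expansion) (auto intro!: closed[OF sub] e f)
  next
    assume "n = 0" "m = 0" "f_coeff y = 0" "h_coeff y = 0"
    then show ?thesis
      by (subst loop_el_expansion) (auto intro!: closed[OF sub] e)
  qed (rule x)
  have "x = Toroidal (loop x) 0 0 0 0"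
    using P by (simp add: toroidal_eq_iff)
  also have "\<dots> \<in> positive_part"
    unfolding loop_expansion
  proof (unfold positive_part_def, rule complex_vector.span_sum, fold positive_part_def)
    fix r assume r: "r \<in> Poly_Mapping.keys (loop x)"
    obtain m n where [simp]: "r = (m, n)" by (cases r)
    let ?y = "Poly_Mapping.lookup (loop x) (m, n)"
    have "\<not> (n < 0 \<or> n = 0 \<and> m < 0)"
      using P r by (auto simp: in_keys_iff)
    then have "(n \<ge> 1 \<or> n = 0 \<and> m \<ge> 1) \<or> n = 0 \<and> m = 0"
      by arith
    then show "loop_el (Poly_Mapping.lookup (loop x) r) (fst r) (snd r) \<in> positive_part"
      using P by (auto intro!: el)
  qed
  finally show "x \<in> positive_part" .
qed

lemma negative_part_iff:
  "x \<in> negative_part \<longleftrightarrow>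
     c1_coeff x = 0 \<and> c2_coeff x = 0 \<and> d1_coeff x = 0 \<and> d2_coeff x = 0
     \<and> (\<forall>m n. n > 0 \<or> n = 0 \<and> m > 0 \<longrightarrow> Poly_Mapping.lookup (loop x) (m, n) = 0)
     \<and> e_coeff (Poly_Mapping.lookup (loop x) (0, 0)) = 0
     \<and> h_coeff (Poly_Mapping.lookup (loop x) (0, 0)) = 0" (is "_ = ?P x")
proof
  have "negative_part \<subseteq> Collect ?P"
    unfolding negative_part_def
  proof (rule complex_vector.span_minimal)
    show "complex_vector.subspace (Collect ?P)"
      by (auto simp: complex_vector.subspace_def toroidal_defs lookup_add sl2_defs)
  qed (auto simp: loop_el_def lookup_single when_def sl2_e_def sl2_f_def sl2_h_def)
  then show "x \<in> negative_part \<Longrightarrow> ?P x"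
    by blast
next
  assume P: "?P x"
  note closed = complex_vector.subspace_add complex_vector.subspace_scale
  have sub: "complex_vector.subspace negative_part"
    by (simp add: negative_part_def)
  have f: "loop_el sl2_f (- m) 0 \<in> negative_part" if "m \<ge> 0" for m
    unfolding negative_part_def using that by (intro complex_vector.span_base) blast
  have e: "loop_el sl2_e (- m) 0 \<in> negative_part" "loop_el sl2_h (- m) 0 \<in> negative_part"
    if "m \<ge> 1" for m
    unfolding negative_part_def using that by (intro complex_vector.span_base; blast)+
  have x: "loop_el x m (- n) \<in> negative_part" if "n \<ge> 1" for x m n
    unfolding negative_part_def using that by (intro complex_vector.span_base) blast
  have el: "loop_el y m n \<in> negative_part"
    if "n \<le> - 1 \<or> n = 0 \<and> m \<le> - 1 \<or> n = 0 \<and> m = 0 \<and> e_coeff y = 0 \<and> h_coeff y = 0" for y m n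
    using that
  proof (elim disjE conjE)
    assume "n \<le> - 1"
    then show ?thesis
      using x[of "- n"] by simp
  next
    assume "n = 0" "m \<le> - 1"
    then show ?thesis
      using e[of "- m"] f[of "- m"] by (subst loop_el_expansion) (auto intro!: closed[OF sub])
  next
    assume "n = 0" "m = 0" "e_coeff y = 0" "h_coeff y = 0"
    then show ?thesis
      using f[of 0] by (subst loop_el_expansion) (auto intro!: closed[OF sub])
  qed
  have "x = Toroidal (loop x) 0 0 0 0"
    using P by (simp add: toroidal_eq_iff)
  also have "\<dots> \<in> negative_part"
    unfolding loop_expansion
  proof (unfold negative_part_def, rule complex_vector.span_sum, fold negative_part_def)
    fix r assume r: "r \<in> Poly_Mapping.keys (loop x)"
    obtain m n where [simp]: "r = (m, n)" by (cases r)
    let ?y = "Poly_Mapping.lookup (loop x) (m, n)"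
    have "\<not> (n > 0 \<or> n = 0 \<and> m > 0)"
      using P r by (auto simp: in_keys_iff)
    then have "(n \<le> - 1 \<or> n = 0 \<and> m \<le> - 1) \<or> n = 0 \<and> m = 0"
      by arith
    then show "loop_el (Poly_Mapping.lookup (loop x) r) (fst r) (snd r) \<in> negative_part"
      using P by (auto intro!: el)
  qed
  finally show "x \<in> negative_part" .
qed

lemma cartan_iff:
  "x \<in> cartan \<longleftrightarrow>
     (\<forall>r. r \<noteq> (0, 0) \<longrightarrow> Poly_Mapping.lookup (loop x) r = 0)
     \<and> e_coeff (Poly_Mapping.lookup (loop x) (0, 0)) = 0
     \<and> f_coeff (Poly_Mapping.lookup (loop x) (0, 0)) = 0" (is "_ = ?P x")
proof
  have "cartan \<subseteq> Collect ?P"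
    unfolding cartan_def
  proof (rule complex_vector.span_minimal)
    show "complex_vector.subspace (Collect ?P)"
      by (auto simp: complex_vector.subspace_def toroidal_defs lookup_add sl2_defs)
  qed (auto simp: tor_basis_defs lookup_single when_def sl2_h_def)
  then show "x \<in> cartan \<Longrightarrow> ?P x"
    by blast
next
  assume P: "?P x"
  have "loop x = Poly_Mapping.single (0, 0) (h_coeff (Poly_Mapping.lookup (loop x) (0, 0)) *\<^sub>C sl2_h)"
  proof (rule poly_mapping_eqI)
    fix r
    show "Poly_Mapping.lookup (loop x) r = Poly_Mapping.lookup
        (Poly_Mapping.single (0, 0) (h_coeff (Poly_Mapping.lookup (loop x) (0, 0)) *\<^sub>C sl2_h)) r"
    proof (cases "r = (0, 0)")
      case True
      then show ?thesis
        using P by (simp add: lookup_single) (simp add: sl2_h_def sl2_eq_iff sl2_defs)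
    next
      case False
      then have "Poly_Mapping.lookup (loop x) r = 0"
        using P by blast
      then show ?thesis
        using False by (simp add: lookup_single when_def)
    qed
  qed
  then have "x = h_coeff (Poly_Mapping.lookup (loop x) (0, 0)) *\<^sub>C loop_el sl2_h 0 0
      + c1_coeff x *\<^sub>C tor_c1 + c2_coeff x *\<^sub>C tor_c2 + d1_coeff x *\<^sub>C tor_d1 + d2_coeff x *\<^sub>C tor_d2"
    by (simp add: toroidal_eq_iff toroidal_defs tor_basis_defs)
  also have "\<dots> \<in> cartan"
    unfolding cartan_def
    by (intro complex_vector.span_add complex_vector.span_scale complex_vector.span_base) simp_all
  finally show "x \<in> cartan" .
qed

text \<open>The projection onto \<open>\<hh>\<close> along \<open>\<TT>\<^sub>+ \<oplus> \<TT>\<^sub>-\<close>.\<close>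

definition cartan_proj :: "toroidal \<Rightarrow> toroidal" where
  "cartan_proj x = Toroidal
     (Poly_Mapping.single (0, 0) (h_coeff (Poly_Mapping.lookup (loop x) (0, 0)) *\<^sub>C sl2_h))
     (c1_coeff x) (c2_coeff x) (d1_coeff x) (d2_coeff x)"

lemma cartan_proj_in [simp]: "cartan_proj x \<in> cartan"
  by (auto simp: cartan_iff cartan_proj_def lookup_single when_def sl2_h_def sl2_defs)

lemma cartan_proj_add: "cartan_proj (x + y) = cartan_proj x + cartan_proj y"
  by (simp add: cartan_proj_def toroidal_defs lookup_add single_add[symmetric])
    (simp add: sl2_h_def sl2_defs)

lemma cartan_proj_scaleC: "cartan_proj (a *\<^sub>C x) = a *\<^sub>C cartan_proj x"
  by (simp add: cartan_proj_def toroidal_defs) (simp add: sl2_h_def sl2_defs)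

lemma cartan_proj_positive: "x \<in> positive_part \<Longrightarrow> cartan_proj x = 0"
  by (simp add: positive_part_iff cartan_proj_def toroidal_defs)

lemma cartan_proj_negative: "x \<in> negative_part \<Longrightarrow> cartan_proj x = 0"
  by (simp add: negative_part_iff cartan_proj_def toroidal_defs)

lemma cartan_proj_cartan: "x \<in> cartan \<Longrightarrow> cartan_proj x = x"
  by (auto simp: cartan_iff cartan_proj_def toroidal_eq_iff lookup_single when_def
      sl2_h_def sl2_eq_iff sl2_defs intro!: poly_mapping_eqI)

lemma borel_part_iff:
  "x \<in> borel_part \<longleftrightarrow>
     (\<forall>m n. n < 0 \<or> n = 0 \<and> m < 0 \<longrightarrow> Poly_Mapping.lookup (loop x) (m, n) = 0)
     \<and> f_coeff (Poly_Mapping.lookup (loop x) (0, 0)) = 0"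
proof
  assume "x \<in> borel_part"
  then show "(\<forall>m n. n < 0 \<or> n = 0 \<and> m < 0 \<longrightarrow> Poly_Mapping.lookup (loop x) (m, n) = 0)
     \<and> f_coeff (Poly_Mapping.lookup (loop x) (0, 0)) = 0"
    by (auto simp: borel_part_def positive_part_iff cartan_iff toroidal_defs lookup_add)
      (auto simp: sl2_defs)
next
  assume B: "(\<forall>m n. n < 0 \<or> n = 0 \<and> m < 0 \<longrightarrow> Poly_Mapping.lookup (loop x) (m, n) = 0)
     \<and> f_coeff (Poly_Mapping.lookup (loop x) (0, 0)) = 0"
  have "x - cartan_proj x \<in> positive_part"
    using B by (auto simp: positive_part_iff cartan_proj_def toroidal_defs lookup_minus
        lookup_single when_def) (auto simp: sl2_h_def sl2_defs)
  then show "x \<in> borel_part"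
    unfolding borel_part_def by (intro CollectI exI[of _ "x - cartan_proj x"] exI[of _ "cartan_proj x"]) simp
qed


section \<open>The subalgebras \<open>\<TT>\<^sub>+ \<oplus> \<hh>\<close> and \<open>\<TT>\<^sub>-\<close> as Lie algebras\<close>

lemma lookup_loop_lie:
  "Poly_Mapping.lookup (loop_lie X Y) t = (\<Sum>r\<in>Poly_Mapping.keys X. \<Sum>s\<in>Poly_Mapping.keys Y.
     if r + s = t then lie (Poly_Mapping.lookup X r) (Poly_Mapping.lookup Y s) else 0)"
  by (simp add: loop_lie_def pm_extend_def lookup_sum lookup_single when_def)

lemma lookup_loop_deriv:
  "Poly_Mapping.lookup (loop_deriv a b X) t =
     (a * of_int (fst t) + b * of_int (snd t)) *\<^sub>C Poly_Mapping.lookup X t"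
  by (induction X rule: pm_induct)
    (auto simp: loop_deriv_add_right lookup_add lookup_single when_def scaleC_add_right)

lemma borel_part_keys:
  "x \<in> borel_part \<Longrightarrow> (m, n) \<in> Poly_Mapping.keys (loop x) \<Longrightarrow> 0 < n \<or> n = 0 \<and> 0 \<le> m"
  unfolding borel_part_iff in_keys_iff by (metis linorder_neqE_linordered_idom not_le)

lemma borel_part_lie:
  assumes "x \<in> borel_part" "y \<in> borel_part"
  shows "lie x y \<in> borel_part"
proof -
  let ?X = "Poly_Mapping.lookup (loop x)" and ?Y = "Poly_Mapping.lookup (loop y)"
  have supp: "0 < n \<or> n = 0 \<and> 0 \<le> m"
    if "(m, n) \<in> Poly_Mapping.keys (loop x) \<or> (m, n) \<in> Poly_Mapping.keys (loop y)" for m n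
    using that assms borel_part_keys by blast
  have "Poly_Mapping.lookup (loop_lie (loop x) (loop y)) (m, n) = 0" if "n < 0 \<or> n = 0 \<and> m < 0" for m n
    unfolding lookup_loop_lie using that
    by (intro sum.neutral ballI) (fastforce dest: supp[OF disjI1] supp[OF disjI2])
  moreover have "f_coeff (Poly_Mapping.lookup (loop_lie (loop x) (loop y)) (0, 0)) = 0"
  proof -
    have f: "f_coeff (sum g A) = (\<Sum>a\<in>A. f_coeff (g a))" for g and A :: "(int \<times> int) set"
      by (induction A rule: infinite_finite_induct) (simp_all add: sl2_defs)
    have "f_coeff (if r + s = (0, 0) then lie (?X r) (?Y s) else 0) = 0"
      if rs: "r \<in> Poly_Mapping.keys (loop x)" "s \<in> Poly_Mapping.keys (loop y)" for r s
    proof (cases "r + s = (0, 0)")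
      case True
      then have "r = (0, 0)" "s = (0, 0)"
        using supp[of "fst r" "snd r"] supp[of "fst s" "snd s"] rs by (auto simp: prod_eq_iff)
      then show ?thesis
        using assms by (simp add: borel_part_iff lie_sl2_def)
    qed simp
    then show ?thesis
      unfolding lookup_loop_lie f by (intro sum.neutral ballI)
  qed
  ultimately show ?thesis
    using assms unfolding borel_part_iff lie_toroidal_def
    by (auto simp: lookup_add lookup_minus lookup_loop_deriv f_coeff_linear)
qed

lemma negative_part_lie:
  assumes "x \<in> negative_part" "y \<in> negative_part"
  shows "lie x y \<in> negative_part"
proof -
  let ?X = "Poly_Mapping.lookup (loop x)" and ?Y = "Poly_Mapping.lookup (loop y)"
  have supp: "n < 0 \<or> n = 0 \<and> m \<le> 0"
    if "(m, n) \<in> Poly_Mapping.keys (loop x) \<or> (m, n) \<in> Poly_Mapping.keys (loop y)" for m n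
    using assms that unfolding negative_part_iff in_keys_iff by (metis linorder_neqE_linordered_idom not_le)
  have "Poly_Mapping.lookup (loop_lie (loop x) (loop y)) (m, n) = 0" if "n > 0 \<or> n = 0 \<and> m > 0" for m n
    unfolding lookup_loop_lie using that
    by (intro sum.neutral ballI) (fastforce dest: supp[OF disjI1] supp[OF disjI2])
  moreover have "Poly_Mapping.lookup (loop_lie (loop x) (loop y)) (0, 0) = 0"
  proof -
    have "(if r + s = (0, 0) then lie (?X r) (?Y s) else 0) = 0"
      if rs: "r \<in> Poly_Mapping.keys (loop x)" "s \<in> Poly_Mapping.keys (loop y)" for r s
    proof (cases "r + s = (0, 0)")
      case True
      then have "r = (0, 0)" "s = (0, 0)"
        using supp[of "fst r" "snd r"] supp[of "fst s" "snd s"] rs by (auto simp: prod_eq_iff)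
      then show ?thesis
        using assms by (simp add: negative_part_iff lie_sl2_def zero_sl2_def)
    qed simp
    then show ?thesis
      unfolding lookup_loop_lie by (intro sum.neutral ballI)
  qed
  moreover have "loop_cocycle p (loop x) (loop y) = 0" if "p (0, 0) = 0" for p
    unfolding loop_cocycle_def pm_extend_def
  proof (intro sum.neutral ballI)
    fix r assume r: "r \<in> Poly_Mapping.keys (loop x)"
    show "of_int (p r) * sl2_form (?X r) (?Y (- r)) = 0"
    proof (cases "- r \<in> Poly_Mapping.keys (loop y)")
      case True
      then have "r = (0, 0)"
        using supp[of "fst r" "snd r"] supp[of "- fst r" "- snd r"] r
        by (cases r) (auto simp: uminus_prod_def)
      then show ?thesis
        using that by simp
    qed (simp add: in_keys_iff)
  qed
  ultimately show ?thesis
    using assms unfolding negative_part_iff lie_toroidal_def by simp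
qed

lemma subspace_borel_part: "complex_vector.subspace borel_part"
  by (auto simp: complex_vector.subspace_def borel_part_iff toroidal_defs lookup_add sl2_defs)

lemma subspace_negative_part: "complex_vector.subspace negative_part"
  by (simp add: negative_part_def)

typedef tor_borel = borel_part
  using subspace_borel_part complex_vector.subspace_0 by blast

typedef tor_minus = negative_part
  using subspace_negative_part complex_vector.subspace_0 by blast

setup_lifting type_definition_tor_borel
setup_lifting type_definition_tor_minus

instantiation tor_borel :: complex_lie_algebra
begin

lift_definition zero_tor_borel :: tor_borel is 0
  by (rule complex_vector.subspace_0[OF subspace_borel_part])
lift_definition plus_tor_borel :: "tor_borel \<Rightarrow> tor_borel \<Rightarrow> tor_borel" is "(+)"
  by (rule complex_vector.subspace_add[OF subspace_borel_part])
lift_definition minus_tor_borel :: "tor_borel \<Rightarrow> tor_borel \<Rightarrow> tor_borel" is "(-)"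
  by (rule complex_vector.subspace_diff[OF subspace_borel_part])
lift_definition uminus_tor_borel :: "tor_borel \<Rightarrow> tor_borel" is uminus
  by (rule complex_vector.subspace_neg[OF subspace_borel_part])
lift_definition scaleC_tor_borel :: "complex \<Rightarrow> tor_borel \<Rightarrow> tor_borel" is scaleC
  by (rule complex_vector.subspace_scale[OF subspace_borel_part])
lift_definition lie_tor_borel :: "tor_borel \<Rightarrow> tor_borel \<Rightarrow> tor_borel" is lie
  by (rule borel_part_lie)

instance
  by standard (transfer, (rule scaleC_add_left scaleC_add_right scaleC_scaleC scaleC_one
      lie_add_left lie_add_right lie_scaleC_left lie_scaleC_right lie_self lie_jacobi
      add.assoc add.commute | simp))+

end

instantiation tor_minus :: complex_lie_algebra
begin

lift_definition zero_tor_minus :: tor_minus is 0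
  by (rule complex_vector.subspace_0[OF subspace_negative_part])
lift_definition plus_tor_minus :: "tor_minus \<Rightarrow> tor_minus \<Rightarrow> tor_minus" is "(+)"
  by (rule complex_vector.subspace_add[OF subspace_negative_part])
lift_definition minus_tor_minus :: "tor_minus \<Rightarrow> tor_minus \<Rightarrow> tor_minus" is "(-)"
  by (rule complex_vector.subspace_diff[OF subspace_negative_part])
lift_definition uminus_tor_minus :: "tor_minus \<Rightarrow> tor_minus" is uminus
  by (rule complex_vector.subspace_neg[OF subspace_negative_part])
lift_definition scaleC_tor_minus :: "complex \<Rightarrow> tor_minus \<Rightarrow> tor_minus" is scaleC
  by (rule complex_vector.subspace_scale[OF subspace_negative_part])
lift_definition lie_tor_minus :: "tor_minus \<Rightarrow> tor_minus \<Rightarrow> tor_minus" is lie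
  by (rule negative_part_lie)

instance
  by standard (transfer, (rule scaleC_add_left scaleC_add_right scaleC_scaleC scaleC_one
      lie_add_left lie_add_right lie_scaleC_left lie_scaleC_right lie_self lie_jacobi
      add.assoc add.commute | simp))+

end


section \<open>Universal enveloping algebras\<close>

text \<open>The tensor algebra of \<open>L\<close> is presented as the free associative algebra on the set \<open>L\<close>
  modulo linearity of the generators, so \<open>U(L)\<close> is the free algebra modulo the two-sided
  ideal generated by the linearity relations and \<open>x y - y x - [x, y]\<close>.\<close>

datatype 'a word = Word (letters: "'a list")

instantiation word :: (type) monoid_add
begin

definition "0 = Word []"
definition "v + w = Word (letters v @ letters w)"

instance
  by standard (simp_all add: zero_word_def plus_word_def)

end

instance poly_mapping :: (monoid_add, complex_algebra_1) complex_algebra_1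
proof
  fix a :: complex and X Y :: "'a \<Rightarrow>\<^sub>0 'b"
  show "(a *\<^sub>C X) * Y = a *\<^sub>C (X * Y)"
  proof (induction X rule: pm_induct)
    case (single r x)
    show ?case
      by (induction Y rule: pm_induct)
        (simp_all add: mult_single distrib_left scaleC_add_right mult_scaleC_left)
  qed (simp_all add: distrib_right scaleC_add_right)
  show "X * (a *\<^sub>C Y) = a *\<^sub>C (X * Y)"
  proof (induction X rule: pm_induct)
    case (single r x)
    show ?case
      by (induction Y rule: pm_induct)
        (simp_all add: mult_single distrib_left scaleC_add_right mult_scaleC_right)
  qed (simp_all add: distrib_right scaleC_add_right)
qed

definition gen :: "'a \<Rightarrow> ('a word \<Rightarrow>\<^sub>0 complex)" where
  "gen x = Poly_Mapping.single (Word [x]) 1"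

inductive_set uea_ideal :: "('a::complex_lie_algebra word \<Rightarrow>\<^sub>0 complex) set" where
  gen_add: "gen (x + y) - gen x - gen y \<in> uea_ideal"
| gen_scaleC: "gen (a *\<^sub>C x) - a *\<^sub>C gen x \<in> uea_ideal"
| gen_lie: "gen x * gen y - gen y * gen x - gen (lie x y) \<in> uea_ideal"
| zero: "0 \<in> uea_ideal"
| add: "p \<in> uea_ideal \<Longrightarrow> q \<in> uea_ideal \<Longrightarrow> p + q \<in> uea_ideal"
| mult_left: "p \<in> uea_ideal \<Longrightarrow> q * p \<in> uea_ideal"
| mult_right: "p \<in> uea_ideal \<Longrightarrow> p * q \<in> uea_ideal"

lemma uea_ideal_uminus: "p \<in> uea_ideal \<Longrightarrow> - p \<in> uea_ideal"
  using uea_ideal.mult_left[of p "- 1"] by simp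

lemma uea_ideal_scaleC: "p \<in> uea_ideal \<Longrightarrow> a *\<^sub>C p \<in> uea_ideal"
  using uea_ideal.mult_left[of p "a *\<^sub>C 1"] by (simp add: mult_scaleC_left)

lemma uea_ideal_diff: "p \<in> uea_ideal \<Longrightarrow> q \<in> uea_ideal \<Longrightarrow> p - q \<in> uea_ideal"
  using uea_ideal.add[of p "- q"] uea_ideal_uminus[of q] by simp

definition uea_rel ::
    "('a::complex_lie_algebra word \<Rightarrow>\<^sub>0 complex) \<Rightarrow> ('a word \<Rightarrow>\<^sub>0 complex) \<Rightarrow> bool" where
  "uea_rel p q \<longleftrightarrow> p - q \<in> uea_ideal"

lemma equivp_uea_rel: "equivp uea_rel"
proof (intro equivpI reflpI sympI transpI)
  fix p q r :: "'a word \<Rightarrow>\<^sub>0 complex"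
  show "uea_rel p p"
    by (simp add: uea_rel_def uea_ideal.zero)
  show "uea_rel p q \<Longrightarrow> uea_rel q p"
    unfolding uea_rel_def using uea_ideal_uminus[of "p - q"] by simp
  show "uea_rel p q \<Longrightarrow> uea_rel q r \<Longrightarrow> uea_rel p r"
    unfolding uea_rel_def using uea_ideal.add[of "p - q" "q - r"] by simp
qed

text \<open>The extension of \<open>\<phi> : L \<rightarrow> A\<close> to the free algebra.\<close>

definition free_eval :: "('a \<Rightarrow> 'r::complex_algebra_1) \<Rightarrow> ('a word \<Rightarrow>\<^sub>0 complex) \<Rightarrow> 'r" where
  "free_eval \<phi> p = pm_extend (\<lambda>w a. a *\<^sub>C prod_list (map \<phi> (letters w))) p"

lemma free_eval_zero [simp]: "free_eval \<phi> 0 = 0"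
  by (simp add: free_eval_def)

lemma free_eval_add: "free_eval \<phi> (p + q) = free_eval \<phi> p + free_eval \<phi> q"
  unfolding free_eval_def by (rule pm_extend_add) (simp_all add: scaleC_add_left)

lemma free_eval_diff: "free_eval \<phi> (p - q) = free_eval \<phi> p - free_eval \<phi> q"
  by (metis add_diff_cancel diff_add_cancel free_eval_add)

lemma free_eval_single [simp]:
  "free_eval \<phi> (Poly_Mapping.single w a) = a *\<^sub>C prod_list (map \<phi> (letters w))"
  by (simp add: free_eval_def pm_extend_single)

lemma free_eval_gen [simp]: "free_eval \<phi> (gen x) = \<phi> x"
  by (simp add: gen_def scaleC_one)

lemma free_eval_one [simp]: "free_eval \<phi> 1 = 1"
  by (simp add: single_one[symmetric] zero_word_def scaleC_one del: single_one)

lemma free_eval_mult: "free_eval \<phi> (p * q) = free_eval \<phi> p * free_eval \<phi> q"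
proof (induction p rule: pm_induct)
  case (single w a)
  show ?case
    by (induction q rule: pm_induct)
      (simp_all add: mult_single plus_word_def distrib_left free_eval_add mult_scaleC_left
        mult_scaleC_right scaleC_scaleC mult.commute)
qed (simp_all add: distrib_right free_eval_add)

lemma free_eval_scaleC: "free_eval \<phi> (a *\<^sub>C p) = a *\<^sub>C free_eval \<phi> p"
  by (induction p rule: pm_induct)
    (simp_all add: scaleC_add_right free_eval_add scaleC_scaleC scaleC_complex_def)

definition lie_hom :: "('a::complex_lie_algebra \<Rightarrow> 'r::complex_algebra_1) \<Rightarrow> bool" where
  "lie_hom \<phi> \<longleftrightarrow> (\<forall>x y. \<phi> (x + y) = \<phi> x + \<phi> y) \<and> (\<forall>a x. \<phi> (a *\<^sub>C x) = a *\<^sub>C \<phi> x)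
     \<and> (\<forall>x y. \<phi> (lie x y) = \<phi> x * \<phi> y - \<phi> y * \<phi> x)"

lemma free_eval_ideal:
  assumes "lie_hom \<phi>" "p \<in> uea_ideal"
  shows "free_eval \<phi> p = 0"
  using assms(2) assms(1)
  by induction
    (simp_all add: lie_hom_def free_eval_add free_eval_diff free_eval_mult free_eval_scaleC)

quotient_type (overloaded) 'a uea = "'a::complex_lie_algebra word \<Rightarrow>\<^sub>0 complex" / uea_rel
  by (rule equivp_uea_rel)

instantiation uea :: (complex_lie_algebra) complex_algebra_1
begin

lift_definition zero_uea :: "'a uea" is 0 .
lift_definition one_uea :: "'a uea" is 1 .
lift_definition plus_uea :: "'a uea \<Rightarrow> 'a uea \<Rightarrow> 'a uea" is "(+)"
  unfolding uea_rel_def by (metis add_diff_add uea_ideal.add)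
lift_definition minus_uea :: "'a uea \<Rightarrow> 'a uea \<Rightarrow> 'a uea" is "(-)"
proof -
  fix p p' q q' :: "'a word \<Rightarrow>\<^sub>0 complex"
  assume "uea_rel p p'" "uea_rel q q'"
  then have "(p - p') - (q - q') \<in> uea_ideal"
    unfolding uea_rel_def by (rule uea_ideal_diff)
  then show "uea_rel (p - q) (p' - q')"
    unfolding uea_rel_def by (simp add: algebra_simps)
qed
lift_definition uminus_uea :: "'a uea \<Rightarrow> 'a uea" is uminus
  unfolding uea_rel_def by (metis minus_diff_minus uea_ideal_uminus)
lift_definition scaleC_uea :: "complex \<Rightarrow> 'a uea \<Rightarrow> 'a uea" is scaleC
  unfolding uea_rel_def
  by (simp add: complex_vector.scale_right_diff_distrib[symmetric] uea_ideal_scaleC)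
lift_definition times_uea :: "'a uea \<Rightarrow> 'a uea \<Rightarrow> 'a uea" is "(*)"
proof -
  fix p p' q q' :: "'a word \<Rightarrow>\<^sub>0 complex"
  assume "uea_rel p p'" "uea_rel q q'"
  then have "(p - p') * q + p' * (q - q') \<in> uea_ideal"
    unfolding uea_rel_def by (intro uea_ideal.add uea_ideal.mult_left uea_ideal.mult_right)
  then show "uea_rel (p * q) (p' * q')"
    unfolding uea_rel_def by (simp add: left_diff_distrib right_diff_distrib)
qed

instance
proof
  have "lie_hom (\<lambda>x :: 'a. 0 :: complex)"
    by (simp add: lie_hom_def)
  then have "(1 :: 'a word \<Rightarrow>\<^sub>0 complex) \<notin> uea_ideal"
    using free_eval_ideal[of "\<lambda>x. 0 :: complex" 1] by force
  then show "(0 :: 'a uea) \<noteq> 1"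
    by transfer (use uea_ideal_uminus[of "- 1"] in \<open>auto simp: uea_rel_def\<close>)
  fix a b c :: "'a uea" and x y :: complex
  note eq = equivp_reflp[OF equivp_uea_rel]
  have eqI: "p = q \<Longrightarrow> uea_rel p q" for p q :: "'a word \<Rightarrow>\<^sub>0 complex"
    using eq by simp
  show "a + b + c = a + (b + c)" by transfer (rule eqI, rule add.assoc)
  show "a + b = b + a" by transfer (rule eqI, rule add.commute)
  show "0 + a = a" by transfer (rule eqI, simp)
  show "- a + a = 0" by transfer (rule eqI, simp)
  show "a - b = a + - b" by transfer (rule eqI, simp)
  show "a * b * c = a * (b * c)" by transfer (rule eqI, rule mult.assoc)
  show "1 * a = a" by transfer (rule eqI, simp)
  show "a * 1 = a" by transfer (rule eqI, simp)
  show "(a + b) * c = a * c + b * c" by transfer (rule eqI, rule distrib_right)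
  show "a * (b + c) = a * b + a * c" by transfer (rule eqI, rule distrib_left)
  show "x *\<^sub>C (a + b) = x *\<^sub>C a + x *\<^sub>C b" by transfer (rule eqI, rule scaleC_add_right)
  show "(x + y) *\<^sub>C a = x *\<^sub>C a + y *\<^sub>C a" by transfer (rule eqI, rule scaleC_add_left)
  show "x *\<^sub>C (y *\<^sub>C a) = (x * y) *\<^sub>C a" by transfer (rule eqI, rule scaleC_scaleC)
  show "1 *\<^sub>C a = a" by transfer (rule eqI, rule scaleC_one)
  show "(x *\<^sub>C a) * b = x *\<^sub>C (a * b)" by transfer (rule eqI, rule mult_scaleC_left)
  show "a * (x *\<^sub>C b) = x *\<^sub>C (a * b)" by transfer (rule eqI, rule mult_scaleC_right)
qed

end

lift_definition uea_gen :: "'a::complex_lie_algebra \<Rightarrow> 'a uea" is gen .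

lemma lie_hom_uea_gen: "lie_hom uea_gen"
  unfolding lie_hom_def
proof (intro conjI allI)
  fix x y :: 'a and a :: complex
  show "uea_gen (x + y) = uea_gen x + uea_gen y"
    by transfer (metis diff_diff_eq uea_ideal.gen_add uea_rel_def)
  show "uea_gen (a *\<^sub>C x) = a *\<^sub>C uea_gen x"
    by transfer (metis uea_ideal.gen_scaleC uea_rel_def)
  show "uea_gen (lie x y) = uea_gen x * uea_gen y - uea_gen y * uea_gen x"
    by transfer (metis uea_ideal.gen_lie uea_ideal_uminus minus_diff_eq uea_rel_def)
qed

text \<open>The homomorphism \<open>U(L) \<rightarrow> A\<close> extending a Lie algebra homomorphism \<open>\<phi> : L \<rightarrow> A\<close>; it is
  meaningful only if \<open>lie_hom \<phi>\<close>, since otherwise it depends on the representative.\<close>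

definition uea_extend ::
    "('a::complex_lie_algebra \<Rightarrow> 'r::complex_algebra_1) \<Rightarrow> 'a uea \<Rightarrow> 'r" where
  "uea_extend \<phi> u = free_eval \<phi> (rep_uea u)"

lemma uea_extend_abs:
  assumes "lie_hom \<phi>"
  shows "uea_extend \<phi> (abs_uea p) = free_eval \<phi> p"
proof -
  have "uea_rel (rep_uea (abs_uea p)) p"
    using Quotient3_uea by (metis Quotient3_abs_rep uea.abs_eq_iff)
  then have "free_eval \<phi> (rep_uea (abs_uea p) - p) = 0"
    using free_eval_ideal[OF assms] unfolding uea_rel_def by blast
  then show ?thesis
    by (simp add: uea_extend_def free_eval_diff)
qed

lemma uea_extend_hom:
  assumes "lie_hom \<phi>"
  shows "uea_extend \<phi> (uea_gen x) = \<phi> x"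
    and "uea_extend \<phi> 1 = 1"
    and "uea_extend \<phi> (u + v) = uea_extend \<phi> u + uea_extend \<phi> v"
    and "uea_extend \<phi> (a *\<^sub>C u) = a *\<^sub>C uea_extend \<phi> u"
    and "uea_extend \<phi> (u * v) = uea_extend \<phi> u * uea_extend \<phi> v"
proof -
  note ext = uea_extend_abs[OF assms]
  obtain p q where [simp]: "u = abs_uea p" "v = abs_uea q"
    by (metis Quotient3_abs_rep Quotient3_uea)
  show "uea_extend \<phi> (uea_gen x) = \<phi> x"
    by (simp add: uea_gen.abs_eq ext)
  show "uea_extend \<phi> 1 = 1"
    by (simp add: one_uea_def ext)
  show "uea_extend \<phi> (u + v) = uea_extend \<phi> u + uea_extend \<phi> v"
    by (simp add: plus_uea.abs_eq ext free_eval_add)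
  show "uea_extend \<phi> (a *\<^sub>C u) = a *\<^sub>C uea_extend \<phi> u"
    by (simp add: scaleC_uea.abs_eq ext free_eval_scaleC)
  show "uea_extend \<phi> (u * v) = uea_extend \<phi> u * uea_extend \<phi> v"
    by (simp add: times_uea.abs_eq ext free_eval_mult)
qed

definition uea_ring :: "'a::complex_lie_algebra uea ring" where
  "uea_ring = \<lparr>carrier = UNIV, mult = (*), one = 1, zero = 0, add = (+)\<rparr>"

section \<open>Tensor products over a noncommutative ring\<close>

text \<open>\<open>A \<otimes>\<^sub>R B\<close> for a right module \<open>A\<close> with action \<open>ra\<close> and a left module \<open>B\<close> with action \<open>la\<close>.\<close>

definition tensor_rels ::
    "('a::ab_group_add \<Rightarrow> 'r \<Rightarrow> 'a) \<Rightarrow> ('r \<Rightarrow> 'b::ab_group_add \<Rightarrow> 'b) \<Rightarrow> ('a \<times> 'b \<Rightarrow>\<^sub>0 int) set" where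
  "tensor_rels ra la =
     {frag_of (u + u', z) - frag_of (u, z) - frag_of (u', z) |u u' z. True}
     \<union> {frag_of (u, z + z') - frag_of (u, z) - frag_of (u, z') |u z z'. True}
     \<union> {frag_of (ra u b, z) - frag_of (u, la b z) |u b z. True}"

definition tensor_null ::
    "('a::ab_group_add \<Rightarrow> 'r \<Rightarrow> 'a) \<Rightarrow> ('r \<Rightarrow> 'b::ab_group_add \<Rightarrow> 'b) \<Rightarrow> ('a \<times> 'b \<Rightarrow>\<^sub>0 int) set" where
  "tensor_null ra la = generate (free_Abelian_group UNIV) (tensor_rels ra la)"

definition tensor_product ::
    "('a::ab_group_add \<Rightarrow> 'r \<Rightarrow> 'a) \<Rightarrow> ('r \<Rightarrow> 'b::ab_group_add \<Rightarrow> 'b)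
      \<Rightarrow> ('a \<times> 'b \<Rightarrow>\<^sub>0 int) set monoid" where
  "tensor_product ra la = free_Abelian_group UNIV Mod tensor_null ra la"

definition pure_tensor ::
    "('a::ab_group_add \<Rightarrow> 'r \<Rightarrow> 'a) \<Rightarrow> ('r \<Rightarrow> 'b::ab_group_add \<Rightarrow> 'b)
      \<Rightarrow> 'a \<Rightarrow> 'b \<Rightarrow> ('a \<times> 'b \<Rightarrow>\<^sub>0 int) set" where
  "pure_tensor ra la u z = tensor_null ra la #>\<^bsub>free_Abelian_group UNIV\<^esub> frag_of (u, z)"

section \<open>Verma modules\<close>

definition borel_incl :: "tor_borel uea \<Rightarrow> toroidal uea" where
  "borel_incl = uea_extend (\<lambda>x. uea_gen (Rep_tor_borel x))"

definition minus_incl :: "tor_minus uea \<Rightarrow> toroidal uea" where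
  "minus_incl = uea_extend (\<lambda>x. uea_gen (Rep_tor_minus x))"

definition dual_space :: "'a::complex_vector set \<Rightarrow> ('a \<Rightarrow> complex) set" where
  "dual_space V = {l. (\<forall>x\<in>V. \<forall>y\<in>V. l (x + y) = l x + l y) \<and> (\<forall>a. \<forall>x\<in>V. l (a *\<^sub>C x) = a * l x)}"

text \<open>The character by which \<open>U(\<TT>\<^sub>+ \<oplus> \<hh>)\<close> acts on \<open>\<complex>1\<^sub>\<lambda>\<close>; only the restriction of \<open>l\<close> to
  \<open>\<hh>\<close> enters.\<close>

definition borel_char :: "(toroidal \<Rightarrow> complex) \<Rightarrow> tor_borel uea \<Rightarrow> complex" where
  "borel_char l = uea_extend (\<lambda>x. l (cartan_proj (Rep_tor_borel x)))"

lemma lie_hom_borel_incl: "lie_hom (\<lambda>x. uea_gen (Rep_tor_borel x))"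
  using lie_hom_uea_gen[where 'a = toroidal]
  by (simp add: lie_hom_def plus_tor_borel.rep_eq scaleC_tor_borel.rep_eq lie_tor_borel.rep_eq)

lemma lie_hom_minus_incl: "lie_hom (\<lambda>x. uea_gen (Rep_tor_minus x))"
  using lie_hom_uea_gen[where 'a = toroidal]
  by (simp add: lie_hom_def plus_tor_minus.rep_eq scaleC_tor_minus.rep_eq lie_tor_minus.rep_eq)

lemma borel_part_lie_cartan_proj:
  assumes "x \<in> borel_part" "y \<in> borel_part"
  shows "cartan_proj (lie x y) = 0"
proof -
  let ?X = "Poly_Mapping.lookup (loop x)" and ?Y = "Poly_Mapping.lookup (loop y)"
  have zero: "r = (0, 0)"
    if "r \<in> Poly_Mapping.keys (loop x)" "s \<in> Poly_Mapping.keys (loop y)" "r + s = (0, 0)" for r s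
    using that borel_part_keys[OF assms(1), of "fst r" "snd r"]
      borel_part_keys[OF assms(2), of "fst s" "snd s"] by (auto simp: prod_eq_iff)
  have h: "h_coeff (sum g A) = (\<Sum>a\<in>A. h_coeff (g a))" for g and A :: "(int \<times> int) set"
    by (induction A rule: infinite_finite_induct) (simp_all add: sl2_defs)
  have "h_coeff (if r + s = (0, 0) then lie (?X r) (?Y s) else 0) = 0"
    if rs: "r \<in> Poly_Mapping.keys (loop x)" "s \<in> Poly_Mapping.keys (loop y)" for r s
  proof (cases "r + s = (0, 0)")
    case True
    with zero[OF rs True] have "r = (0, 0)" "s = (0, 0)"
      by (auto simp: prod_eq_iff)
    then show ?thesis
      using assms by (simp add: borel_part_iff lie_sl2_def)
  qed simp
  then have "h_coeff (Poly_Mapping.lookup (loop_lie (loop x) (loop y)) (0, 0)) = 0"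
    unfolding lookup_loop_lie h by (intro sum.neutral ballI)
  moreover have "loop_cocycle p (loop x) (loop y) = 0" if "p (0, 0) = 0" for p
    unfolding loop_cocycle_def pm_extend_def
  proof (intro sum.neutral ballI)
    fix r assume r: "r \<in> Poly_Mapping.keys (loop x)"
    show "of_int (p r) * sl2_form (?X r) (?Y (- r)) = 0"
    proof (cases "- r \<in> Poly_Mapping.keys (loop y)")
      case True
      then have "r = (0, 0)"
        using zero[OF r True] by (simp add: zero_prod_def)
      then show ?thesis
        using that by simp
    qed (simp add: in_keys_iff)
  qed
  ultimately show ?thesis
    by (simp add: cartan_proj_def lie_toroidal_def lookup_add lookup_minus lookup_loop_deriv
        zero_toroidal_def plus_sl2_def minus_sl2_def)
qed

lemma lie_hom_borel_char:
  assumes "l \<in> dual_space cartan"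
  shows "lie_hom (\<lambda>x. l (cartan_proj (Rep_tor_borel x)))"
proof -
  have "l (0 *\<^sub>C 0) = 0 * l 0"
    using assms complex_vector.subspace_0[of cartan] unfolding dual_space_def cartan_def
    by (metis (mono_tags, lifting) complex_vector.span_zero mem_Collect_eq)
  then have "l 0 = 0"
    by simp
  then show ?thesis
    using assms Rep_tor_borel
    by (simp add: lie_hom_def dual_space_def plus_tor_borel.rep_eq scaleC_tor_borel.rep_eq
        lie_tor_borel.rep_eq cartan_proj_add cartan_proj_scaleC borel_part_lie_cartan_proj
        scaleC_complex_def)
qed

definition verma_right :: "toroidal uea \<Rightarrow> tor_borel uea \<Rightarrow> toroidal uea" where
  "verma_right u b = u * borel_incl b"

definition verma_left :: "(toroidal \<Rightarrow> complex) \<Rightarrow> tor_borel uea \<Rightarrow> complex \<Rightarrow> complex" where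
  "verma_left l b z = borel_char l b * z"

text \<open>\<open>M(\<lambda>)\<close> as a left \<open>U(\<TT>)\<close>-module, with \<open>a (u \<otimes> z) = (a u) \<otimes> z\<close>. The multiplication fields
  of the record, which come from its being an extension of rings, are not used.\<close>

definition verma ::
    "(toroidal \<Rightarrow> complex) \<Rightarrow> (toroidal uea, (toroidal uea \<times> complex \<Rightarrow>\<^sub>0 int) set) module" where
  "verma l = \<lparr>
     carrier = carrier (tensor_product verma_right (verma_left l)),
     mult = undefined,
     one = undefined,
     zero = one (tensor_product verma_right (verma_left l)),
     add = mult (tensor_product verma_right (verma_left l)),
     smult = (\<lambda>a X. \<Union>c\<in>X. tensor_null verma_right (verma_left l)
       #>\<^bsub>free_Abelian_group UNIV\<^esub> frag_extend (\<lambda>(u, z). frag_of (a * u, z)) c)\<rparr>"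

definition verma_vector :: "(toroidal \<Rightarrow> complex) \<Rightarrow> (toroidal uea \<times> complex \<Rightarrow>\<^sub>0 int) set" where
  "verma_vector l = pure_tensor verma_right (verma_left l) 1 1"

lemma verma_smult:
  "a \<odot>\<^bsub>verma l\<^esub> pure_tensor verma_right (verma_left l) u z
     = pure_tensor verma_right (verma_left l) (a * u) z"
proof -
  let ?F = "free_Abelian_group (UNIV :: (toroidal uea \<times> complex) set)"
  let ?N = "tensor_null verma_right (verma_left l)"
  define h where "h = frag_extend (\<lambda>(u, z :: complex). frag_of (a * u, z))"
  interpret F: comm_group ?F
    by (rule abelian_free_Abelian_group)
  have N: "subgroup ?N ?F"
    unfolding tensor_null_def by (rule F.generate_is_subgroup) (simp add: free_Abelian_group_def)
  have hN: "h n \<in> ?N" if "n \<in> ?N" for n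
    using that unfolding tensor_null_def
  proof induction
    case one
    then show ?case
      by (simp add: h_def generate.one[of ?F, simplified])
  next
    case (incl r)
    have "h r \<in> tensor_rels verma_right (verma_left l)"
      using incl unfolding tensor_rels_def h_def
      by (auto simp: frag_extend_diff distrib_left verma_right_def mult.assoc[symmetric]; blast)
    then show ?case
      by (rule generate.incl)
  next
    case (inv r)
    have "h r \<in> tensor_rels verma_right (verma_left l)"
      using inv unfolding tensor_rels_def h_def
      by (auto simp: frag_extend_diff distrib_left verma_right_def mult.assoc[symmetric]; blast)
    then show ?case
      using generate.inv[of "h r" _ ?F] by (simp add: h_def frag_extend_minus)
  next
    case (eng x y)
    then show ?case
      using generate.eng[of "h x" ?F _ "h y"] by (simp add: h_def frag_extend_add)
  qed
  have coset: "?N #>\<^bsub>?F\<^esub> h c = ?N #>\<^bsub>?F\<^esub> frag_of (a * u, z)"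
    if c: "c \<in> ?N #>\<^bsub>?F\<^esub> frag_of (u, z)" for c
  proof -
    obtain n where n: "n \<in> ?N" "c = n + frag_of (u, z)"
      using c by (auto simp: r_coset_def)
    then have "h c = h n + frag_of (a * u, z)"
      by (simp add: h_def frag_extend_add)
    then have "h c \<in> ?N #>\<^bsub>?F\<^esub> frag_of (a * u, z)"
      using hN[OF n(1)] by (auto simp: r_coset_def)
    then show ?thesis
      using F.repr_independence[OF _ _ N] by (simp add: free_Abelian_group_def)
  qed
  have "frag_of (u, z) \<in> ?N #>\<^bsub>?F\<^esub> frag_of (u, z)"
    by (rule F.rcos_self[OF _ N]) simp
  then show ?thesis
    using coset by (simp add: pure_tensor_def verma_def h_def[symmetric]) blast
qed

definition minus_orbit ::
    "(toroidal \<Rightarrow> complex) \<Rightarrow> (toroidal uea \<times> complex \<Rightarrow>\<^sub>0 int) set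
      \<Rightarrow> (toroidal uea \<times> complex \<Rightarrow>\<^sub>0 int) set set" where
  "minus_orbit l w = {minus_incl u \<odot>\<^bsub>verma l\<^esub> w |u. True}"

definition proper_submodule :: "'b set \<Rightarrow> ('a, 'c) ring_scheme \<Rightarrow> ('a, 'b, 'd) module_scheme \<Rightarrow> bool" where
  "proper_submodule H R M \<longleftrightarrow> submodule H R M \<and> H \<noteq> carrier M"

definition y0 :: toroidal where "y0 = loop_el sl2_e (- 1) 0"
definition y1 :: toroidal where "y1 = loop_el sl2_f 0 0"

definition coroot0 :: toroidal where "coroot0 = tor_c1 - loop_el sl2_h 0 0"
definition coroot1 :: toroidal where "coroot1 = loop_el sl2_h 0 0"

end

theory Submission
  imports Defs
begin

text \<open>The claim has two halves: the sum is stable under all of \<open>U(\<TT>)\<close>, and it misses \<open>v\<^sub>\<lambda>\<close>.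

  Stability. Each \<open>y\<^sub>i\<close> belongs to an \<open>sl\<^sub>2\<close>-triple with coroot \<open>\<alpha>\<^sub>i\<^sup>\<or>\<close>, and \<open>\<lambda>(\<alpha>\<^sub>i\<^sup>\<or>) = n\<^sub>i\<close> makes the
  raising element of the triple kill the vector that \<open>y\<^sub>i\<close> to the power \<open>n\<^sub>i + 1\<close> produces from
  \<open>v\<^sub>\<lambda>\<close>. The other spanning elements of \<open>\<TT>\<^sub>+\<close> lie in a set that annihilates \<open>v\<^sub>\<lambda>\<close> and is stable
  under \<open>ad y\<^sub>i\<close>, so they kill all \<open>y\<^sub>i\<close>-powers of \<open>v\<^sub>\<lambda>\<close> (\<open>singular_y0\<close>, \<open>singular_y1\<close>). For a vector that
  is a common eigenvector of \<open>\<TT>\<^sub>+ \<oplus> \<hh>\<close>, the span under \<open>U(\<TT>\<^sub>-)\<close> is already the span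
  under \<open>U(\<TT>)\<close> (\<open>minus_orbit_stable_mod_left_ideal\<close>).

  Properness. This needs a lower bound on the Verma module, already to exclude \<open>v\<^sub>\<lambda> = 0\<close>. It comes
  from a linear functional on \<open>U(\<TT>)\<close>, the vacuum expectation value. Extend \<open>\<lambda>\<close> by \<open>0\<close> to \<open>\<TT>\<^sub>+\<close>.
  The functional sends \<open>1\<close> to \<open>1\<close>, it kills \<open>\<TT>\<^sub>- U(\<TT>)\<close>, and for \<open>b \<in> \<TT>\<^sub>+ \<oplus> \<hh>\<close> its value
  at \<open>u b\<close> is \<open>\<lambda>(b)\<close> times its value at \<open>u\<close>. By the last property it is defined on the Verma
  module, by the second it kills the sum of the two orbits, because positive powers of
  \<open>y\<^sub>i \<in> \<TT>\<^sub>-\<close> lie in \<open>\<TT>\<^sub>- U(\<TT>)\<close>, and by the first it does not kill \<open>v\<^sub>\<lambda>\<close>. The three properties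
  determine its value on words recursively: the rightmost letter splits into a part in
  \<open>\<TT>\<^sub>+ \<oplus> \<hh>\<close>, which becomes a scalar, and a part in \<open>\<TT>\<^sub>-\<close>, which is commuted to the far left,
  where it dies, leaving brackets in shorter words. That this recursion respects
  \<open>x y - y x = [x, y]\<close> (\<open>vac_swap\<close>) holds for any Lie algebra that is the direct sum of two
  subalgebras, with a character on one of them.\<close>

section \<open>The vacuum expectation value on words\<close>

lemma lie_uminus: "lie (- x) y = - lie x y" "lie x (- y) = - lie x y" for x y :: "'a::complex_lie_algebra"
  using lie_scaleC_left[of "- 1" x y] lie_scaleC_right[of x "- 1" y] by simp_all

lemma lie_diff: "lie (x - y) z = lie x z - lie y z" "lie x (y - z) = lie x y - lie x z"
  for x y z :: "'a::complex_lie_algebra"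
  using lie_add_left[of x "- y" z] lie_add_right[of x y "- z"] by (simp_all add: lie_uminus)

lemma lie_lie_left: "lie (lie x y) z = lie (lie x z) y + lie x (lie y z)"
  for x y z :: "'a::complex_lie_algebra"
proof -
  have "lie z (lie x y) = - lie (lie x y) z" "lie y (lie z x) = lie (lie x z) y"
    using lie_skew[of z "lie x y"] lie_skew[of y "lie z x"] lie_skew[of z x] by (simp_all add: lie_uminus)
  then show ?thesis
    using lie_jacobi[of x y z] by (simp add: algebra_simps add_eq_0_iff)
qed

text \<open>The value of \<open>f\<close> on \<open>D\<^sub>n w\<close>, where \<open>D\<^sub>n\<close> is the derivation of the free algebra that extends
  \<open>x \<mapsto> [x, n]\<close>: the sum of \<open>f\<close> over the words that arise from \<open>w\<close> by replacing one letter \<open>x\<close>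
  by \<open>[x, n]\<close>.\<close>

primrec dsum :: "('a::complex_lie_algebra list \<Rightarrow> complex) \<Rightarrow> 'a \<Rightarrow> 'a list \<Rightarrow> complex" where
  "dsum f n [] = 0"
| "dsum f n (x # w) = f (lie x n # w) + dsum (\<lambda>v. f (x # v)) n w"

lemma dsum_cong [fundef_cong]:
  assumes "n = m" "w = w'" "\<And>v. length v = length w' \<Longrightarrow> f v = g v"
  shows "dsum f n w = dsum g m w'"
  unfolding assms(1,2) using assms(3)
proof (induction w' arbitrary: f g)
  case (Cons x w)
  have "dsum (\<lambda>v. f (x # v)) m w = dsum (\<lambda>v. g (x # v)) m w"
    by (rule Cons.IH) (rule Cons.prems, simp)
  moreover have "f (lie x m # w) = g (lie x m # w)"
    by (rule Cons.prems) simp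
  ultimately show ?case
    by (simp only: dsum.simps)
qed (simp only: dsum.simps)

lemma dsum_append:
  "dsum f n (a @ b) = dsum (\<lambda>v. f (v @ b)) n a + dsum (\<lambda>v. f (a @ v)) n b"
  by (induction a arbitrary: f) simp_all

lemma dsum_add_fun: "dsum (\<lambda>v. f v + g v) n w = dsum f n w + dsum g n w"
  by (induction w arbitrary: f g) simp_all

lemma dsum_diff_fun: "dsum (\<lambda>v. f v - g v) n w = dsum f n w - dsum g n w"
  by (induction w arbitrary: f g) simp_all

lemma dsum_mult_fun: "dsum (\<lambda>v. a * f v) n w = a * dsum f n w"
  by (induction w arbitrary: f) (simp_all add: algebra_simps)

lemma dsum_zero_fun: "dsum (\<lambda>v. 0) n w = 0"
  by (induction w) simp_all

text \<open>Linearity in each letter is needed for functions on words that are only under control up to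
  a given length, because the recursion below shortens words.\<close>

definition multilinear_upto :: "nat \<Rightarrow> ('a::complex_lie_algebra list \<Rightarrow> complex) \<Rightarrow> bool" where
  "multilinear_upto k f \<longleftrightarrow>
     (\<forall>a x y c. length a + length c < k \<longrightarrow> f (a @ (x + y) # c) = f (a @ x # c) + f (a @ y # c)) \<and>
     (\<forall>a s x c. length a + length c < k \<longrightarrow> f (a @ (s *\<^sub>C x) # c) = s * f (a @ x # c))"

lemma multilinear_uptoD:
  assumes "multilinear_upto k f" "length a + length c < k"
  shows "f (a @ (x + y) # c) = f (a @ x # c) + f (a @ y # c)"
    and "f (a @ (s *\<^sub>C x) # c) = s * f (a @ x # c)"
  using assms unfolding multilinear_upto_def by blast+

lemma multilinear_upto_Cons:
  assumes "multilinear_upto (Suc k) f"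
  shows "multilinear_upto k (\<lambda>v. f (x # v))"
  using multilinear_uptoD[OF assms, of "x # _"] unfolding multilinear_upto_def by simp

lemma multilinear_upto_mono: "multilinear_upto k f \<Longrightarrow> m \<le> k \<Longrightarrow> multilinear_upto m f"
  unfolding multilinear_upto_def by (meson order_less_le_trans)

lemma dsum_linear:
  assumes "multilinear_upto (length w) f"
  shows "dsum f (m + n) w = dsum f m w + dsum f n w"
    and "dsum f (s *\<^sub>C n) w = s * dsum f n w"
proof -
  have "dsum f (m + n) w = dsum f m w + dsum f n w \<and> dsum f (s *\<^sub>C n) w = s * dsum f n w"
    using assms
  proof (induction w arbitrary: f)
    case (Cons x w)
    have "multilinear_upto (length w) (\<lambda>v. f (x # v))"
      using Cons.prems by (simp add: multilinear_upto_Cons)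
    note IH = Cons.IH[OF this]
    show ?case
      using IH multilinear_uptoD[OF Cons.prems, of "[]" w]
      by (simp add: lie_add_right lie_scaleC_right algebra_simps)
  qed simp
  then show "dsum f (m + n) w = dsum f m w + dsum f n w" "dsum f (s *\<^sub>C n) w = s * dsum f n w"
    by blast+
qed

text \<open>\<open>D\<^sub>m D\<^sub>n - D\<^sub>n D\<^sub>m = D\<^bsub>[n, m]\<^esub>\<close>: both sides are derivations, and on a single letter this is the
  Jacobi identity.\<close>

lemma dsum_commutator:
  assumes "\<And>k. multilinear_upto k f"
  shows "dsum (dsum f m) n w - dsum (dsum f n) m w = dsum f (lie n m) w"
  using assms
proof (induction w arbitrary: f)
  case (Cons x w)
  have ml: "multilinear_upto k (\<lambda>v. f (x # v))" for k
    by (rule multilinear_upto_Cons) (rule Cons.prems)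
  have "lie (lie x n) m = lie x (lie n m) + lie (lie x m) n"
    using lie_lie_left[of x n m] by (simp add: add.commute)
  then have "f (lie (lie x n) m # w) = f (lie x (lie n m) # w) + f (lie (lie x m) n # w)"
    using multilinear_uptoD(1)[OF Cons.prems, of "[]" w "Suc (length w)"] by simp
  then show ?case
    using Cons.IH[OF ml] by (simp add: dsum_add_fun)
qed simp

text \<open>A Lie algebra that is the direct sum of two subalgebras, the range \<open>N\<close> and the kernel \<open>B\<close> of the
  projection \<open>p\<close>, together with a character of \<open>B\<close>, extended by \<open>0\<close> to \<open>N\<close>.\<close>

locale polarized_character =
  fixes p :: "'a::complex_lie_algebra \<Rightarrow> 'a" and \<chi> :: "'a \<Rightarrow> complex"
  assumes p_add: "p (x + y) = p x + p y" and p_scale: "p (s *\<^sub>C x) = s *\<^sub>C p x"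
    and p_idem: "p (p x) = p x"
    and p_range_lie: "p (lie (p x) (p y)) = lie (p x) (p y)"
    and p_kernel_lie: "p x = 0 \<Longrightarrow> p y = 0 \<Longrightarrow> p (lie x y) = 0"
    and \<chi>_add: "\<chi> (x + y) = \<chi> x + \<chi> y" and \<chi>_scale: "\<chi> (s *\<^sub>C x) = s * \<chi> x"
    and \<chi>_range: "\<chi> (p x) = 0"
    and \<chi>_kernel_lie: "p x = 0 \<Longrightarrow> p y = 0 \<Longrightarrow> \<chi> (lie x y) = 0"
begin

text \<open>The vacuum expectation value of a word \<open>w x\<close>, stored with the rightmost letter first. Split
  \<open>x = n + b\<close> with \<open>n \<in> N\<close> and \<open>b \<in> B\<close>. On the highest weight vector \<open>b\<close> acts by \<open>\<chi> b\<close>, and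
  \<open>w n = n w + D\<^sub>n w\<close>, where \<open>n w\<close> should have expectation \<open>0\<close>. The remaining words have the length
  of \<open>w\<close>, so these two demands leave no choice and define a function by recursion on the length.
  The lemmas below show that it does have the properties that led to it.\<close>

function vac :: "'a list \<Rightarrow> complex" where
  "vac [] = 1"
| "vac (x # w) = \<chi> x * vac w + dsum vac (p x) w"
  by pat_completeness auto
termination
  by (relation "measure length") auto

lemma multilinear_vac: "multilinear_upto k vac"
proof (induction k)
  case 0
  then show ?case by (simp add: multilinear_upto_def)
next
  case (Suc k)
  have "vac (a @ (x + y) # c) = vac (a @ x # c) + vac (a @ y # c)"
    if len: "length a + length c < Suc k" for a x y c
  proof (cases a)
    case Nil
    with len have "multilinear_upto (length c) vac"
      by (intro multilinear_upto_mono[OF Suc]) simp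
    then show ?thesis
      by (simp add: Nil p_add \<chi>_add dsum_linear algebra_simps)
  next
    case (Cons z a')
    have len: "length a' + length c < k"
      using that Cons by simp
    have "dsum (\<lambda>v. vac (v @ (x + y) # c)) (p z) a' =
        dsum (\<lambda>v. vac (v @ x # c) + vac (v @ y # c)) (p z) a'"
      by (rule dsum_cong) (use len Suc in \<open>simp_all add: multilinear_uptoD\<close>)
    moreover have "dsum (\<lambda>v. vac (a' @ (x + y) # v)) (p z) c =
        dsum (\<lambda>v. vac (a' @ x # v) + vac (a' @ y # v)) (p z) c"
      by (rule dsum_cong) (use len Suc in \<open>simp_all add: multilinear_uptoD\<close>)
    ultimately show ?thesis
      using multilinear_uptoD(1)[OF Suc len]
      by (simp add: Cons dsum_append dsum_add_fun lie_add_left algebra_simps)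
  qed
  moreover have "vac (a @ (s *\<^sub>C x) # c) = s * vac (a @ x # c)"
    if len: "length a + length c < Suc k" for a s x c
  proof (cases a)
    case Nil
    with len have "multilinear_upto (length c) vac"
      by (intro multilinear_upto_mono[OF Suc]) simp
    then show ?thesis
      by (simp add: Nil p_scale \<chi>_scale dsum_linear algebra_simps)
  next
    case (Cons z a')
    have len: "length a' + length c < k"
      using that Cons by simp
    have "dsum (\<lambda>v. vac (v @ (s *\<^sub>C x) # c)) (p z) a' = dsum (\<lambda>v. s * vac (v @ x # c)) (p z) a'"
      by (rule dsum_cong) (use len Suc in \<open>simp_all add: multilinear_uptoD\<close>)
    moreover have "dsum (\<lambda>v. vac (a' @ (s *\<^sub>C x) # v)) (p z) c = dsum (\<lambda>v. s * vac (a' @ x # v)) (p z) c"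
      by (rule dsum_cong) (use len Suc in \<open>simp_all add: multilinear_uptoD\<close>)
    ultimately show ?thesis
      using multilinear_uptoD(2)[OF Suc len]
      by (simp add: Cons dsum_append dsum_mult_fun lie_scaleC_left algebra_simps)
  qed
  ultimately show ?case
    unfolding multilinear_upto_def by blast
qed

lemma vac_add: "vac (a @ (x + y) # c) = vac (a @ x # c) + vac (a @ y # c)"
  and vac_scaleC: "vac (a @ (s *\<^sub>C x) # c) = s * vac (a @ x # c)"
  using multilinear_uptoD[OF multilinear_vac lessI] by blast+

lemma vac_uminus: "vac (a @ (- x) # c) = - vac (a @ x # c)"
  using vac_scaleC[of a "- 1" x c] by simp

lemma vac_diff: "vac (a @ (x - y) # c) = vac (a @ x # c) - vac (a @ y # c)"
  using vac_add[of a x "- y" c] by (simp add: vac_uminus)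

text \<open>Elements of \<open>N\<close> on the left of a product are annihilated. The recursion at the right end either
  keeps the leftmost letter \<open>n\<close> or replaces it by a bracket of two elements of \<open>N\<close>, which lies in
  \<open>N\<close> again.\<close>

lemma vac_range_last: "p n = n \<Longrightarrow> vac (w @ [n]) = 0"
proof (induction "length w" arbitrary: w n)
  case 0
  then show ?case using \<chi>_range[of n] by simp
next
  case (Suc k)
  then obtain x w' where w: "w = x # w'" "length w' = k"
    by (cases w) auto
  have "dsum (\<lambda>v. vac (v @ [n])) (p x) w' = dsum (\<lambda>v. 0) (p x) w'"
    by (rule dsum_cong) (use Suc w in auto)
  moreover have "vac (w' @ [lie n (p x)]) = 0"
    using Suc.hyps(1)[of w' "lie n (p x)"] w p_range_lie[of n x] Suc.prems by simp
  moreover have "vac (w' @ [n]) = 0"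
    using Suc.hyps(1)[of w' n] w Suc.prems by simp
  ultimately show ?case
    by (simp add: w dsum_append dsum_zero_fun)
qed

lemma vac_kernel_first: "p b = 0 \<Longrightarrow> vac (b # w) = \<chi> b * vac w"
  using dsum_linear(2)[OF multilinear_vac, of 0 0 w]
  by simp

text \<open>The relation \<open>x y - y x = [x, y]\<close> at the right end of a word. With \<open>x = x\<^sub>N + x\<^sub>B\<close> and
  \<open>y = y\<^sub>N + y\<^sub>B\<close>, unfolding the recursion twice leaves an antisymmetric second order term, which
  is first order by \<open>dsum_commutator\<close> and equals the value at \<open>[y\<^sub>N, x\<^sub>N] \<in> N\<close>. Together with
  the first order terms \<open>[x, y\<^sub>N] - [y, x\<^sub>N]\<close> this gives \<open>[x, y] - [x\<^sub>B, y\<^sub>B]\<close>, and the character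
  of \<open>B\<close> vanishes on \<open>[x\<^sub>B, y\<^sub>B]\<close>.\<close>

lemma vac_swap_first: "vac (y # x # a) - vac (x # y # a) = vac (lie x y # a)"
proof -
  have exp: "vac (y # x # a) = \<chi> y * \<chi> x * vac a + \<chi> y * dsum vac (p x) a
      + vac (lie x (p y) # a) + \<chi> x * dsum vac (p y) a + dsum (dsum vac (p x)) (p y) a" for x y
    by (simp add: dsum_add_fun dsum_mult_fun algebra_simps)
  define m where "m = lie (p y) (p x)"
  have "p m = m" by (simp add: m_def p_range_lie)
  then have "vac (m # a) = dsum vac m a"
    using \<chi>_range[of m] by simp
  then have "vac (y # x # a) - vac (x # y # a)
      = vac (m # a) + vac (lie x (p y) # a) - vac (lie y (p x) # a)"
    using dsum_commutator[OF multilinear_vac, of "p x" "p y" a]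
    unfolding exp[of x y] exp[of y x] m_def by simp
  also have "\<dots> = vac ((m + lie x (p y) - lie y (p x)) # a)"
    using vac_add[of "[]"] vac_diff[of "[]"] by simp
  also have "m + lie x (p y) - lie y (p x) = lie x y - lie (x - p x) (y - p y)"
    using lie_skew[of "p x" "p y"] lie_skew[of "p x" y]
    by (simp add: m_def lie_diff algebra_simps)
  also have "vac (\<dots> # a) = vac (lie x y # a) - vac (lie (x - p x) (y - p y) # a)"
    using vac_diff[of "[]"] by simp
  also have "vac (lie (x - p x) (y - p y) # a) = 0"
  proof -
    have "p (x - p x) = 0" for x
      using p_add[of "x - p x" "p x"] p_idem[of x] by simp
    then show ?thesis
      by (simp add: vac_kernel_first p_kernel_lie \<chi>_kernel_lie del: vac.simps)
  qed
  finally show ?thesis by simp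
qed

text \<open>The same relation anywhere in a word: a derivation \<open>D\<^sub>n\<close> respects it, by the Jacobi identity.\<close>

lemma vac_swap: "vac (c @ y # x # a) - vac (c @ x # y # a) = vac (c @ lie x y # a)"
proof (induction "length c + length a" arbitrary: c x y a rule: less_induct)
  case less
  show ?case
  proof (cases c)
    case Nil
    then show ?thesis using vac_swap_first by simp
  next
    case (Cons z c')
    define n where "n = p z"
    note IH = less.hyps[of c' a, unfolded Cons, simplified]
    have 1: "dsum (\<lambda>v. vac (v @ y # x # a)) n c' - dsum (\<lambda>v. vac (v @ x # y # a)) n c'
        = dsum (\<lambda>v. vac (v @ lie x y # a)) n c'"
      unfolding dsum_diff_fun[symmetric] by (rule dsum_cong) (use less.hyps in \<open>auto simp: Cons\<close>)
    have 2: "dsum (\<lambda>v. vac (c' @ y # x # v)) n a - dsum (\<lambda>v. vac (c' @ x # y # v)) n a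
        = dsum (\<lambda>v. vac (c' @ lie x y # v)) n a"
      unfolding dsum_diff_fun[symmetric] by (rule dsum_cong) (use less.hyps in \<open>auto simp: Cons\<close>)
    have "lie (lie x y) n = lie (lie x n) y + lie x (lie y n)"
      by (rule lie_lie_left)
    then have "vac (c' @ lie (lie x y) n # a) = vac (c' @ lie (lie x n) y # a) + vac (c' @ lie x (lie y n) # a)"
      by (simp add: vac_add)
    also have "\<dots> = vac (c' @ y # lie x n # a) - vac (c' @ lie x n # y # a)
        + vac (c' @ lie y n # x # a) - vac (c' @ x # lie y n # a)"
      using IH by simp
    finally have 3: "vac (c' @ lie (lie x y) n # a) = \<dots>" .
    show ?thesis
      using 1 2 3 IH[of y x] unfolding Cons
      by (simp add: dsum_append n_def[symmetric] algebra_simps)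
  qed
qed

end

section \<open>The vacuum functional on the enveloping algebra\<close>

text \<open>An additive functional vanishes on the defining ideal of \<open>U(L)\<close> as soon as it vanishes on each
  defining relation multiplied by monomials on both sides.\<close>

lemma uea_ideal_sandwich_induct:
  fixes F :: "('a::complex_lie_algebra word \<Rightarrow>\<^sub>0 complex) \<Rightarrow> complex"
  assumes F_add: "\<And>p q. F (p + q) = F p + F q"
    and gen_add: "\<And>v w x y a b.
      F (Poly_Mapping.single v a * (gen (x + y) - gen x - gen y) * Poly_Mapping.single w b) = 0"
    and gen_scaleC: "\<And>v w s x a b.
      F (Poly_Mapping.single v a * (gen (s *\<^sub>C x) - s *\<^sub>C gen x) * Poly_Mapping.single w b) = 0"
    and gen_lie: "\<And>v w x y a b.
      F (Poly_Mapping.single v a * (gen x * gen y - gen y * gen x - gen (lie x y)) * Poly_Mapping.single w b) = 0"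
    and "p \<in> uea_ideal"
  shows "F p = 0"
proof -
  have F_zero: "F 0 = 0"
    using F_add[of 0 0] by simp
  have sandwich: "F (q * g * r) = 0"
    if g: "\<And>v w a b. F (Poly_Mapping.single v a * g * Poly_Mapping.single w b) = 0" for g q r
  proof (induction q rule: pm_induct)
    case (single v a)
    show ?case
      by (induction r rule: pm_induct) (simp_all add: F_zero F_add distrib_left g)
  qed (simp_all add: F_zero F_add distrib_right)
  have "F (q * p * r) = 0" for q r
    using assms(5)
  proof (induction arbitrary: q r)
    case (mult_left p s)
    show ?case
      using mult_left.IH[of "q * s" r] by (simp only: mult.assoc)
  next
    case (mult_right p s)
    show ?case
      using mult_right.IH[of q "s * r"] by (simp only: mult.assoc)
  qed (simp_all add: sandwich gen_add gen_scaleC gen_lie F_zero F_add distrib_left distrib_right)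
  from this[of 1 1] show ?thesis by simp
qed

lemma uea_cases: obtains q where "u = abs_uea q"
  by (metis Quotient3_abs_rep Quotient3_uea)

context polarized_character
begin

definition vac_free :: "('a word \<Rightarrow>\<^sub>0 complex) \<Rightarrow> complex" where
  "vac_free = pm_extend (\<lambda>w a. a * vac (rev (letters w)))"

lemma vac_free_add: "vac_free (q + r) = vac_free q + vac_free r"
  unfolding vac_free_def by (rule pm_extend_add) (simp_all add: distrib_right)

lemma vac_free_diff: "vac_free (q - r) = vac_free q - vac_free r"
  by (metis add_diff_cancel diff_add_cancel vac_free_add)

lemma vac_free_single: "vac_free (Poly_Mapping.single w a) = a * vac (rev (letters w))"
  by (simp add: vac_free_def pm_extend_single)

lemma vac_free_scaleC: "vac_free (s *\<^sub>C q) = s * vac_free q"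
  by (induction q rule: pm_induct)
    (simp_all add: vac_free_def[THEN fun_cong, of 0] vac_free_single vac_free_add
      scaleC_add_right distrib_left scaleC_complex_def)

lemma vac_free_ideal: "q \<in> uea_ideal \<Longrightarrow> vac_free q = 0"
proof (rule uea_ideal_sandwich_induct[where F = vac_free])
  fix v w :: "'a word" and x y :: 'a and s a b :: complex
  note simps = gen_def algebra_simps mult_single vac_free_add vac_free_diff vac_free_single plus_word_def
    scaleC_complex_def vac_add vac_scaleC vac_swap[symmetric]
  show "vac_free (Poly_Mapping.single v a * (gen (x + y) - gen x - gen y) * Poly_Mapping.single w b) = 0"
    by (simp add: simps)
  show "vac_free (Poly_Mapping.single v a * (gen (s *\<^sub>C x) - s *\<^sub>C gen x) * Poly_Mapping.single w b) = 0"
    by (simp add: simps)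
  show "vac_free (Poly_Mapping.single v a * (gen x * gen y - gen y * gen x - gen (lie x y))
      * Poly_Mapping.single w b) = 0"
    by (simp add: simps)
qed (simp_all add: vac_free_add)

definition vac_uea :: "'a uea \<Rightarrow> complex" where
  "vac_uea u = vac_free (rep_uea u)"

lemma vac_uea_abs: "vac_uea (abs_uea q) = vac_free q"
proof -
  have "uea_rel (rep_uea (abs_uea q)) q"
    using Quotient3_uea by (metis Quotient3_abs_rep uea.abs_eq_iff)
  then show ?thesis
    using vac_free_ideal[of "rep_uea (abs_uea q) - q"]
    by (simp add: uea_rel_def vac_uea_def vac_free_diff)
qed

lemma vac_uea_add: "vac_uea (u + v) = vac_uea u + vac_uea v"
  by (rule uea_cases[of u]; rule uea_cases[of v]) (simp add: plus_uea.abs_eq vac_uea_abs vac_free_add)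

lemma vac_uea_scaleC: "vac_uea (s *\<^sub>C u) = s * vac_uea u"
  by (rule uea_cases[of u]) (simp add: scaleC_uea.abs_eq vac_uea_abs vac_free_scaleC)

lemma vac_uea_one: "vac_uea 1 = 1"
  by (simp add: one_uea_def vac_uea_abs single_one[symmetric] vac_free_single zero_word_def del: single_one)

lemma vac_uea_range_mult:
  assumes "p n = n"
  shows "vac_uea (uea_gen n * u) = 0"
proof (rule uea_cases[of u])
  fix q assume u: "u = abs_uea q"
  have "vac_free (gen n * q) = 0"
    by (induction q rule: pm_induct)
      (simp_all add: vac_free_def[THEN fun_cong, of 0] vac_free_add distrib_left gen_def mult_single
        vac_free_single plus_word_def vac_range_last[OF assms])
  then show ?thesis
    by (simp add: u uea_gen.abs_eq times_uea.abs_eq vac_uea_abs)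
qed

lemma vac_uea_mult_kernel:
  assumes "p b = 0"
  shows "vac_uea (u * uea_gen b) = \<chi> b * vac_uea u"
proof (rule uea_cases[of u])
  fix q assume u: "u = abs_uea q"
  have "vac_free (q * gen b) = \<chi> b * vac_free q"
    by (induction q rule: pm_induct)
      (simp_all add: vac_free_def[THEN fun_cong, of 0] vac_free_add distrib_left distrib_right gen_def mult_single
        vac_free_single plus_word_def vac_kernel_first[OF assms] del: vac.simps)
  then show ?thesis
    by (simp add: u uea_gen.abs_eq times_uea.abs_eq vac_uea_abs)
qed

end

lemma uea_left_induct [case_names one add scaleC mult_gen]:
  assumes "P 1" and add: "\<And>u v. P u \<Longrightarrow> P v \<Longrightarrow> P (u + v)" and "\<And>s u. P u \<Longrightarrow> P (s *\<^sub>C u)"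
    and mult: "\<And>x u. P u \<Longrightarrow> P (uea_gen x * u)"
  shows "P u"
proof (rule uea_cases[of u])
  fix q assume u: "u = abs_uea q"
  have "P (abs_uea q)"
  proof (induction q rule: pm_induct)
    case zero
    then show ?case
      using assms(3)[OF assms(1), of 0] by (simp add: zero_uea_def[symmetric])
  next
    case (single w a)
    have "P (abs_uea (Poly_Mapping.single (Word xs) 1))" for xs
    proof (induction xs)
      case Nil
      then show ?case
        using assms(1) by (simp add: one_uea_def zero_word_def[symmetric])
    next
      case (Cons x xs)
      have "Poly_Mapping.single (Word (x # xs)) 1 = gen x * Poly_Mapping.single (Word xs) 1"
        by (simp add: gen_def mult_single plus_word_def)
      then show ?case
        using mult[OF Cons, of x] by (simp add: uea_gen.abs_eq times_uea.abs_eq)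
    qed
    from assms(3)[OF this[of "letters w"], of a] show ?case
      by (simp add: scaleC_uea.abs_eq scaleC_complex_def)
  next
    case (add q r)
    then show ?case using assms(2) by (metis plus_uea.abs_eq)
  qed
  then show ?thesis by (simp add: u)
qed

section \<open>Powers of a generator modulo a left ideal\<close>

definition left_ideal :: "'r::ring_1 set \<Rightarrow> bool" where
  "left_ideal J \<longleftrightarrow> 0 \<in> J \<and> (\<forall>u\<in>J. \<forall>v\<in>J. u + v \<in> J) \<and> (\<forall>a. \<forall>u\<in>J. a * u \<in> J)"

lemma left_ideal_closed:
  assumes "left_ideal J"
  shows "0 \<in> J" "u \<in> J \<Longrightarrow> v \<in> J \<Longrightarrow> u + v \<in> J" "u \<in> J \<Longrightarrow> a * u \<in> J"
    "u \<in> J \<Longrightarrow> - u \<in> J" "u \<in> J \<Longrightarrow> v \<in> J \<Longrightarrow> u - v \<in> J"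
proof -
  show *: "0 \<in> J" "u \<in> J \<Longrightarrow> v \<in> J \<Longrightarrow> u + v \<in> J" "u \<in> J \<Longrightarrow> a * u \<in> J" for u v a
    using assms unfolding left_ideal_def by blast+
  show "u \<in> J \<Longrightarrow> - u \<in> J" "u \<in> J \<Longrightarrow> v \<in> J \<Longrightarrow> u - v \<in> J" for u v
    using *(3)[of u "- 1"] *(2)[of u "- v"] *(3)[of v "- 1"] by simp_all
qed

lemma left_ideal_scaleC:
  fixes u :: "'r::complex_algebra_1"
  shows "left_ideal J \<Longrightarrow> u \<in> J \<Longrightarrow> s *\<^sub>C u \<in> J"
  using left_ideal_closed(3)[of J u "s *\<^sub>C 1"] by (simp add: mult_scaleC_left)

lemma uea_gen_linear:
  "uea_gen (x + y) = uea_gen x + uea_gen y" "uea_gen (s *\<^sub>C x) = s *\<^sub>C uea_gen x"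
  "uea_gen (lie x y) = uea_gen x * uea_gen y - uea_gen y * uea_gen x"
  using lie_hom_uea_gen unfolding lie_hom_def by blast+

text \<open>The left ideals below are annihilators of highest weight vectors \<open>v\<close>. If a set of Lie algebra elements
  kills \<open>v\<close> and is stable under \<open>ad y\<close>, then it kills \<open>y\<^sup>k v\<close>, since \<open>x y = y x + [x, y]\<close>.\<close>

lemma mult_power_in_left_ideal:
  assumes J: "left_ideal J" and A: "\<And>x. x \<in> A \<Longrightarrow> uea_gen x \<in> J" "\<And>x. x \<in> A \<Longrightarrow> lie x y \<in> A"
  shows "x \<in> A \<Longrightarrow> uea_gen x * uea_gen y ^ k \<in> J"
proof (induction k arbitrary: x)
  case 0
  then show ?case using A by simp
next
  case (Suc k)
  have "uea_gen x * uea_gen y ^ Suc k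
      = uea_gen y * (uea_gen x * uea_gen y ^ k) + uea_gen (lie x y) * uea_gen y ^ k"
    by (simp add: uea_gen_linear algebra_simps)
  then show ?case
    using Suc A(2) left_ideal_closed[OF J] by simp
qed

lemma weight_power_mod_left_ideal:
  assumes J: "left_ideal J" and h: "uea_gen h - \<mu> *\<^sub>C 1 \<in> J" and hy: "lie h y = c *\<^sub>C y"
  shows "uea_gen h * uea_gen y ^ k - (\<mu> + of_nat k * c) *\<^sub>C uea_gen y ^ k \<in> J"
proof (induction k)
  case 0
  then show ?case using h by simp
next
  case (Suc k)
  let ?y = "uea_gen y"
  have "uea_gen h * ?y = ?y * uea_gen h + c *\<^sub>C ?y"
    using uea_gen_linear(3)[of h y] by (simp add: hy uea_gen_linear(2))
  then have "uea_gen h * ?y ^ Suc k = ?y * (uea_gen h * ?y ^ k) + c *\<^sub>C ?y ^ Suc k"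
    by (simp add: mult.assoc[symmetric] distrib_right mult_scaleC_left)
  then have "uea_gen h * ?y ^ Suc k - (\<mu> + of_nat (Suc k) * c) *\<^sub>C ?y ^ Suc k
      = ?y * (uea_gen h * ?y ^ k - (\<mu> + of_nat k * c) *\<^sub>C ?y ^ k)"
    by (simp add: mult_scaleC_right scaleC_add_left distrib_right right_diff_distrib algebra_simps)
  then show ?case
    using left_ideal_closed(3)[OF J Suc] by simp
qed

text \<open>The \<open>sl\<^sub>2\<close> computation \<open>e y\<^sup>k\<^sup>+\<^sup>1 v = (k + 1) (\<mu> - k) y\<^sup>k v\<close>. The factor vanishes when \<open>\<mu> = k\<close>: this
  is where dominance of the weight enters.\<close>

lemma sl2_triple_mod_left_ideal:
  assumes J: "left_ideal J" and e: "uea_gen e \<in> J" and h: "uea_gen h - \<mu> *\<^sub>C 1 \<in> J"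
    and ey: "lie e y = h" and hy: "lie h y = (- 2) *\<^sub>C y"
  shows "uea_gen e * uea_gen y ^ Suc k - (of_nat (Suc k) * (\<mu> - of_nat k)) *\<^sub>C uea_gen y ^ k \<in> J"
proof (induction k)
  case 0
  have "uea_gen e * uea_gen y - \<mu> *\<^sub>C 1 = uea_gen y * uea_gen e + (uea_gen h - \<mu> *\<^sub>C 1)"
    using uea_gen_linear(3)[of e y] by (simp add: ey)
  also have "\<dots> \<in> J"
    using left_ideal_closed(2)[OF J left_ideal_closed(3)[OF J e] h] .
  finally show ?case
    by simp
next
  case (Suc k)
  let ?y = "uea_gen y"
  define c where "c = of_nat (Suc k) * (\<mu> - of_nat k)"
  define d where "d = \<mu> + of_nat (Suc k) * - 2"
  have cd: "of_nat (Suc (Suc k)) * (\<mu> - of_nat (Suc k)) = c + d"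
    by (simp add: c_def d_def algebra_simps)
  have "uea_gen e * ?y = ?y * uea_gen e + uea_gen h"
    using uea_gen_linear(3)[of e y] by (simp add: ey)
  then have "uea_gen e * ?y ^ Suc (Suc k) = ?y * (uea_gen e * ?y ^ Suc k) + uea_gen h * ?y ^ Suc k"
    unfolding power_Suc[of ?y "Suc k"] by (simp only: mult.assoc[symmetric] distrib_right)
  then have "uea_gen e * ?y ^ Suc (Suc k) - (c + d) *\<^sub>C ?y ^ Suc k
      = ?y * (uea_gen e * ?y ^ Suc k - c *\<^sub>C ?y ^ k) + (uea_gen h * ?y ^ Suc k - d *\<^sub>C ?y ^ Suc k)"
    by (simp add: mult_scaleC_right scaleC_add_left right_diff_distrib)
  then show ?case
    using left_ideal_closed(3)[OF J Suc] weight_power_mod_left_ideal[OF J h hy, of "Suc k"]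
      left_ideal_closed(2)[OF J]
    unfolding cd by (simp only: c_def d_def)
qed

section \<open>The vacuum functional of the toroidal Lie algebra\<close>

definition neg_cut :: "int \<times> int \<Rightarrow> sl2 \<Rightarrow> sl2" where
  "neg_cut r x = (if snd r < 0 \<or> snd r = 0 \<and> fst r < 0 then x
     else if r = (0, 0) then Sl2 0 (f_coeff x) 0 else 0)"

text \<open>The projection onto \<open>\<TT>\<^sub>-\<close> along \<open>\<TT>\<^sub>+ \<oplus> \<hh>\<close>.\<close>

definition neg_proj :: "toroidal \<Rightarrow> toroidal" where
  "neg_proj x = Toroidal (Poly_Mapping.mapp neg_cut (loop x)) 0 0 0 0"

lemma neg_cut_linear:
  "neg_cut r 0 = 0" "neg_cut r (x + y) = neg_cut r x + neg_cut r y"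
  "neg_cut r (s *\<^sub>C x) = s *\<^sub>C neg_cut r x"
  by (simp_all add: neg_cut_def sl2_defs)

lemma lookup_neg_proj: "Poly_Mapping.lookup (loop (neg_proj x)) r = neg_cut r (Poly_Mapping.lookup (loop x) r)"
  by (auto simp: neg_proj_def mapp.rep_eq when_def neg_cut_linear in_keys_iff)

lemma neg_proj_coeffs [simp]: "c1_coeff (neg_proj x) = 0" "c2_coeff (neg_proj x) = 0"
    "d1_coeff (neg_proj x) = 0" "d2_coeff (neg_proj x) = 0"
  by (simp_all add: neg_proj_def)

lemma neg_proj_linear: "neg_proj (x + y) = neg_proj x + neg_proj y" "neg_proj (s *\<^sub>C x) = s *\<^sub>C neg_proj x"
  by (auto simp: toroidal_eq_iff plus_toroidal_def scaleC_toroidal_def lookup_add lookup_neg_proj neg_cut_linear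
      intro!: poly_mapping_eqI)

lemma neg_proj_in: "neg_proj x \<in> negative_part"
  by (auto simp: negative_part_iff lookup_neg_proj neg_cut_def)

lemma neg_proj_negative: "x \<in> negative_part \<Longrightarrow> neg_proj x = x"
  by (auto simp: negative_part_iff toroidal_eq_iff lookup_neg_proj neg_cut_def sl2_eq_iff
      intro!: poly_mapping_eqI) (metis linorder_neqE_linordered_idom sl2_zero_coeff)+

lemma neg_proj_borel: "x \<in> borel_part \<Longrightarrow> neg_proj x = 0"
  by (auto simp: borel_part_iff toroidal_eq_iff zero_toroidal_def lookup_neg_proj neg_cut_def sl2_eq_iff
      intro!: poly_mapping_eqI)

lemma neg_proj_zero_iff: "neg_proj x = 0 \<longleftrightarrow> x \<in> borel_part"
proof
  assume "neg_proj x = 0"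
  then have "neg_cut r (Poly_Mapping.lookup (loop x) r) = 0" for r
    using lookup_neg_proj[of x r] by (simp add: zero_toroidal_def)
  note * = this[unfolded neg_cut_def]
  have "Poly_Mapping.lookup (loop x) (m, n) = 0" if "n < 0 \<or> n = 0 \<and> m < 0" for m n
    using *[of "(m, n)"] that by simp
  moreover have "f_coeff (Poly_Mapping.lookup (loop x) (0, 0)) = 0"
    using *[of "(0, 0)"] by (simp add: zero_sl2_def)
  ultimately show "x \<in> borel_part"
    by (simp add: borel_part_iff)
qed (rule neg_proj_borel)

lemma sub_neg_proj_borel: "x - neg_proj x \<in> borel_part"
proof -
  have "neg_proj (x - neg_proj x) = neg_proj x - neg_proj (neg_proj x)"
    by (metis add_diff_cancel diff_add_cancel neg_proj_linear(1))
  then show ?thesis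
    by (simp add: neg_proj_zero_iff[symmetric] neg_proj_negative[OF neg_proj_in])
qed

text \<open>The triangular decomposition is an instance: \<open>N = \<TT>\<^sub>-\<close>, \<open>B = \<TT>\<^sub>+ \<oplus> \<hh>\<close>.\<close>

lemma polarized_character_toroidal:
  assumes "l \<in> dual_space cartan"
  shows "polarized_character neg_proj (\<lambda>x. l (cartan_proj x))"
proof
  have l: "l (x + y) = l x + l y" "l (s *\<^sub>C x) = s * l x" if "x \<in> cartan" "y \<in> cartan" for x y s
    using assms that unfolding dual_space_def by blast+
  have l0: "l 0 = 0"
    using l(2)[of "cartan_proj 0" "cartan_proj 0" 0] by simp
  fix x y s
  show "neg_proj (x + y) = neg_proj x + neg_proj y" "neg_proj (s *\<^sub>C x) = s *\<^sub>C neg_proj x"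
    by (rule neg_proj_linear)+
  show "neg_proj (neg_proj x) = neg_proj x"
    by (rule neg_proj_negative[OF neg_proj_in])
  show "neg_proj (lie (neg_proj x) (neg_proj y)) = lie (neg_proj x) (neg_proj y)"
    by (intro neg_proj_negative negative_part_lie neg_proj_in)
  show "neg_proj x = 0 \<Longrightarrow> neg_proj y = 0 \<Longrightarrow> neg_proj (lie x y) = 0"
    unfolding neg_proj_zero_iff by (rule borel_part_lie)
  show "l (cartan_proj (x + y)) = l (cartan_proj x) + l (cartan_proj y)"
    by (simp add: cartan_proj_add l)
  show "l (cartan_proj (s *\<^sub>C x)) = s * l (cartan_proj x)"
    using l(2)[of "cartan_proj x" "cartan_proj x"] by (simp add: cartan_proj_scaleC)
  show "l (cartan_proj (neg_proj x)) = 0"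
    by (simp add: cartan_proj_negative[OF neg_proj_in] l0)
  show "neg_proj x = 0 \<Longrightarrow> neg_proj y = 0 \<Longrightarrow> l (cartan_proj (lie x y)) = 0"
    unfolding neg_proj_zero_iff by (simp add: borel_part_lie_cartan_proj l0)
qed

lemmas borel_incl_hom = uea_extend_hom[OF lie_hom_borel_incl, folded borel_incl_def]
lemmas minus_incl_hom = uea_extend_hom[OF lie_hom_minus_incl, folded minus_incl_def]

lemma borel_char_hom:
  assumes "l \<in> dual_space cartan"
  shows "borel_char l (uea_gen x) = l (cartan_proj (Rep_tor_borel x))"
    and "borel_char l 1 = 1"
    and "borel_char l (b + c) = borel_char l b + borel_char l c"
    and "borel_char l (s *\<^sub>C b) = s *\<^sub>C borel_char l b"
    and "borel_char l (b * c) = borel_char l b * borel_char l c"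
  unfolding borel_char_def by (rule uea_extend_hom[OF lie_hom_borel_char[OF assms]])+

definition vac_toroidal :: "(toroidal \<Rightarrow> complex) \<Rightarrow> toroidal uea \<Rightarrow> complex" where
  "vac_toroidal l = polarized_character.vac_uea neg_proj (\<lambda>x. l (cartan_proj x))"

lemma vac_toroidal:
  assumes "l \<in> dual_space cartan"
  shows "vac_toroidal l 1 = 1"
    and "vac_toroidal l (u + v) = vac_toroidal l u + vac_toroidal l v"
    and "vac_toroidal l (s *\<^sub>C u) = s * vac_toroidal l u"
    and "y \<in> negative_part \<Longrightarrow> vac_toroidal l (uea_gen y * u) = 0"
    and "x \<in> borel_part \<Longrightarrow> vac_toroidal l (u * uea_gen x) = l (cartan_proj x) * vac_toroidal l u"
proof -
  interpret polarized_character neg_proj "\<lambda>x. l (cartan_proj x)"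
    by (rule polarized_character_toroidal) fact
  show "vac_toroidal l 1 = 1"
    "vac_toroidal l (u + v) = vac_toroidal l u + vac_toroidal l v"
    "vac_toroidal l (s *\<^sub>C u) = s * vac_toroidal l u"
    by (simp_all add: vac_toroidal_def vac_uea_one vac_uea_add vac_uea_scaleC)
  show "y \<in> negative_part \<Longrightarrow> vac_toroidal l (uea_gen y * u) = 0"
    by (simp add: vac_toroidal_def vac_uea_range_mult neg_proj_negative)
  show "x \<in> borel_part \<Longrightarrow> vac_toroidal l (u * uea_gen x) = l (cartan_proj x) * vac_toroidal l u"
    by (simp add: vac_toroidal_def vac_uea_mult_kernel neg_proj_borel)
qed

lemma vac_toroidal_borel:
  assumes l: "l \<in> dual_space cartan"
  shows "vac_toroidal l (u * borel_incl b) = borel_char l b * vac_toroidal l u"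
proof -
  note char = borel_char_hom[OF l]
  note simps = borel_incl_hom char distrib_left distrib_right vac_toroidal[OF l] mult_scaleC_right scaleC_complex_def
  show ?thesis
  proof (induction b arbitrary: u rule: uea_left_induct)
    case one
    show ?case by (simp add: simps)
  next
    case (add b c)
    then show ?case by (simp add: simps)
  next
    case (scaleC s b)
    then show ?case by (simp add: simps)
  next
    case (mult_gen x b)
    have "vac_toroidal l (u * borel_incl (uea_gen x * b))
        = vac_toroidal l ((u * uea_gen (Rep_tor_borel x)) * borel_incl b)"
      by (simp add: simps mult.assoc)
    then show ?case
      unfolding mult_gen by (simp add: simps Rep_tor_borel)
  qed
qed

text \<open>The power of \<open>y\<close> is positive, so also the constant term of the factor from \<open>U(\<TT>\<^sub>-)\<close> contributes only
  products that begin with an element of \<open>\<TT>\<^sub>-\<close>.\<close>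

lemma vac_toroidal_minus:
  assumes l: "l \<in> dual_space cartan" and y: "y \<in> negative_part"
  shows "vac_toroidal l (minus_incl u * uea_gen y ^ Suc k) = 0"
proof (induction u rule: uea_left_induct)
  case one
  show ?case by (simp add: minus_incl_hom vac_toroidal(4)[OF l y])
next
  case (add u v)
  then show ?case by (simp only: minus_incl_hom distrib_right vac_toroidal(2)[OF l]) simp
next
  case (scaleC s u)
  then show ?case by (simp only: minus_incl_hom mult_scaleC_left vac_toroidal(3)[OF l]) simp
next
  case (mult_gen x u)
  have "Rep_tor_minus x \<in> negative_part" by (rule Rep_tor_minus)
  then show ?case by (simp only: minus_incl_hom mult.assoc vac_toroidal(4)[OF l])
qed

section \<open>The Verma module as a quotient of the enveloping algebra\<close>

text \<open>The map \<open>u \<mapsto> u v\<^sub>\<lambda>\<close>. It is additive and onto the Verma module, and it turns the module structure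
  into multiplication in \<open>U(\<TT>)\<close>, so everything below is computed in \<open>U(\<TT>)\<close>.\<close>

definition verma_class :: "(toroidal \<Rightarrow> complex) \<Rightarrow> toroidal uea \<Rightarrow> (toroidal uea \<times> complex \<Rightarrow>\<^sub>0 int) set" where
  "verma_class l u = pure_tensor verma_right (verma_left l) u 1"

lemma smult_verma_class: "a \<odot>\<^bsub>verma l\<^esub> verma_class l u = verma_class l (a * u)"
  unfolding verma_class_def by (rule verma_smult)

lemma verma_vector_class: "verma_vector l = verma_class l 1"
  by (simp add: verma_vector_def verma_class_def)

lemma tensor_null_normal: "tensor_null ra la \<lhd> free_Abelian_group UNIV"
proof -
  interpret F: comm_group "free_Abelian_group UNIV"
    by (rule abelian_free_Abelian_group)
  show ?thesis
    unfolding tensor_null_def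
    by (intro F.subgroup_imp_normal F.generate_is_subgroup) (simp add: free_Abelian_group_def)
qed

lemma tensor_null_closed:
  "0 \<in> tensor_null ra la"
  "c \<in> tensor_null ra la \<Longrightarrow> d \<in> tensor_null ra la \<Longrightarrow> c + d \<in> tensor_null ra la"
  "c \<in> tensor_null ra la \<Longrightarrow> - c \<in> tensor_null ra la"
  using normal_imp_subgroup[OF tensor_null_normal[of ra la]]
    subgroup.one_closed subgroup.m_closed subgroup.m_inv_closed
  by fastforce+

lemma tensor_coset_iff:
  "x \<in> tensor_null ra la #>\<^bsub>free_Abelian_group UNIV\<^esub> c \<longleftrightarrow> x - c \<in> tensor_null ra la"
  unfolding r_coset_def by (auto simp: algebra_simps) (metis diff_add_cancel)

lemma tensor_coset_eq_iff:
  "tensor_null ra la #>\<^bsub>free_Abelian_group UNIV\<^esub> c = tensor_null ra la #>\<^bsub>free_Abelian_group UNIV\<^esub> d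
    \<longleftrightarrow> c - d \<in> tensor_null ra la" (is "?N #>\<^bsub>?F\<^esub> c = _ \<longleftrightarrow> _")
proof
  assume "?N #>\<^bsub>?F\<^esub> c = ?N #>\<^bsub>?F\<^esub> d"
  then show "c - d \<in> ?N"
    using tensor_coset_iff[of c ra la c] tensor_coset_iff[of c ra la d] tensor_null_closed(1) by auto
next
  assume N: "c - d \<in> ?N"
  have "x - c \<in> ?N \<longleftrightarrow> x - d \<in> ?N" for x
    using tensor_null_closed(2)[OF _ N, of "x - c"]
      tensor_null_closed(2)[OF _ tensor_null_closed(3)[OF N], of "x - d"]
    by (auto simp: algebra_simps)
  then show "?N #>\<^bsub>?F\<^esub> c = ?N #>\<^bsub>?F\<^esub> d"
    unfolding set_eq_iff tensor_coset_iff by blast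
qed

lemma pure_tensor_eq_iff:
  "pure_tensor ra la u z = pure_tensor ra la u' z' \<longleftrightarrow> frag_of (u, z) - frag_of (u', z') \<in> tensor_null ra la"
  unfolding pure_tensor_def by (rule tensor_coset_eq_iff)

lemma tensor_null_rels:
  "frag_of (u + u', z) - frag_of (u, z) - frag_of (u', z) \<in> tensor_null ra la"
  "frag_of (ra u b, z) - frag_of (u, la b z) \<in> tensor_null ra la"
proof -
  have "frag_of (u + u', z) - frag_of (u, z) - frag_of (u', z) \<in> tensor_rels ra la"
    "frag_of (ra u b, z) - frag_of (u, la b z) \<in> tensor_rels ra la"
    unfolding tensor_rels_def by fast+
  then show "frag_of (u + u', z) - frag_of (u, z) - frag_of (u', z) \<in> tensor_null ra la"
    "frag_of (ra u b, z) - frag_of (u, la b z) \<in> tensor_null ra la"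
    unfolding tensor_null_def by (blast intro: generate.incl)+
qed

lemma pure_tensor_balanced: "pure_tensor ra la (ra u b) z = pure_tensor ra la u (la b z)"
  unfolding pure_tensor_eq_iff by (rule tensor_null_rels)

lemma pure_tensor_mult:
  "pure_tensor ra la u z \<otimes>\<^bsub>tensor_product ra la\<^esub> pure_tensor ra la u' z = pure_tensor ra la (u + u') z"
proof -
  have "pure_tensor ra la u z \<otimes>\<^bsub>tensor_product ra la\<^esub> pure_tensor ra la u' z
      = tensor_null ra la #>\<^bsub>free_Abelian_group UNIV\<^esub> (frag_of (u, z) + frag_of (u', z))"
    using normal.rcos_sum[OF tensor_null_normal, of "frag_of (u, z)" "frag_of (u', z)" ra la]
    by (simp add: tensor_product_def pure_tensor_def FactGroup_def)
  also have "\<dots> = pure_tensor ra la (u + u') z"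
    unfolding pure_tensor_def tensor_coset_eq_iff
    using tensor_null_closed(3)[OF tensor_null_rels(1)[of u u' z ra la]] by (simp add: algebra_simps)
  finally show ?thesis .
qed

lemma add_verma_class: "verma_class l u \<oplus>\<^bsub>verma l\<^esub> verma_class l v = verma_class l (u + v)"
  unfolding verma_class_def verma_def by (simp add: pure_tensor_mult)

text \<open>The record underlying the additive group of a module carries the extra field of the scalar
  multiplication, so it is not literally the tensor product, and the group laws are transferred.\<close>

lemma group_verma: "group (add_monoid (verma l))"
proof -
  interpret G: group "tensor_product verma_right (verma_left l)"
    unfolding tensor_product_def by (rule normal.factorgroup_is_group[OF tensor_null_normal])
  show ?thesis
    by (rule groupI) (auto simp: verma_def G.m_assoc intro: G.l_inv_ex)
qed

lemma verma_class_uea: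
  "verma_class l (borel_incl b) = pure_tensor verma_right (verma_left l) 1 (borel_char l b)"
  using pure_tensor_balanced[of verma_right "verma_left l" 1 b 1]
  by (simp add: verma_class_def verma_right_def verma_left_def)

lemma pure_tensor_verma:
  assumes "l \<in> dual_space cartan"
  shows "pure_tensor verma_right (verma_left l) u z = verma_class l (z *\<^sub>C u)"
proof -
  note char = borel_char_hom[OF assms]
  have "verma_right u (z *\<^sub>C 1) = z *\<^sub>C u"
    by (simp add: verma_right_def borel_incl_hom mult_scaleC_right)
  moreover have "verma_left l (z *\<^sub>C 1) 1 = z"
    by (simp add: verma_left_def char scaleC_complex_def)
  ultimately show ?thesis
    using pure_tensor_balanced[of verma_right "verma_left l" u "z *\<^sub>C 1" 1]
    by (simp add: verma_class_def)
qed

lemma verma_class_borel: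
  assumes l: "l \<in> dual_space cartan" and x: "x \<in> borel_part"
  shows "verma_class l (uea_gen x) = verma_class l (l (cartan_proj x) *\<^sub>C 1)"
proof -
  note char = borel_char_hom[OF l]
  have "uea_gen x = borel_incl (uea_gen (Abs_tor_borel x))"
    by (simp add: borel_incl_hom Abs_tor_borel_inverse x)
  then show ?thesis
    by (simp only: verma_class_uea char pure_tensor_verma[OF l] Abs_tor_borel_inverse[OF x])
qed

text \<open>Every tensor \<open>u \<otimes> z\<close> equals \<open>z u \<otimes> 1\<close>, because scalars lie in \<open>U(\<TT>\<^sub>+ \<oplus> \<hh>)\<close>; sums and differences
  of such tensors have the same form.\<close>

lemma carrier_verma:
  assumes "l \<in> dual_space cartan"
  shows "carrier (verma l) = range (verma_class l)"
proof -
  let ?N = "tensor_null verma_right (verma_left l)"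
    and ?F = "free_Abelian_group (UNIV :: (toroidal uea \<times> complex) set)"
  have N: "frag_of (u + v, 1) - frag_of (u, 1) - frag_of (v, 1) \<in> ?N" for u v
    by (rule tensor_null_rels)
  have "\<exists>u. c - frag_of (u, 1) \<in> ?N" for c
    using subset_UNIV[of "Poly_Mapping.keys c"]
  proof (induction rule: frag_induction)
    case zero
    show ?case
      using tensor_null_closed(3)[OF N[of 0 0]] N[of 0 0] by (intro exI[of _ 0]) simp
  next
    case (one p)
    obtain u z where p: "p = (u, z)" by (cases p)
    show ?case
      using pure_tensor_verma[OF assms, of u z] unfolding p verma_class_def pure_tensor_eq_iff by blast
  next
    case (diff c d)
    obtain u v where uv: "c - frag_of (u, 1) \<in> ?N" "d - frag_of (v, 1) \<in> ?N"
      using diff.IH by blast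
    have "(c - frag_of (u, 1)) + - (d - frag_of (v, 1))
        + (frag_of (u - v + v, 1) - frag_of (u - v, 1) - frag_of (v, 1)) \<in> ?N"
      by (intro tensor_null_closed uv N)
    then show ?case
      by (intro exI[of _ "u - v"]) (simp add: algebra_simps)
  qed
  then have "?N #>\<^bsub>?F\<^esub> c \<in> range (verma_class l)" for c
    unfolding verma_class_def pure_tensor_def image_iff tensor_coset_eq_iff by blast
  moreover have "verma_class l u \<in> rcosets\<^bsub>?F\<^esub> ?N" for u
    unfolding verma_class_def pure_tensor_def RCOSETS_def by auto
  ultimately show ?thesis
    unfolding verma_def tensor_product_def FactGroup_def by (auto simp: RCOSETS_def)
qed

text \<open>The vacuum functional descends to the Verma module: \<open>u \<otimes> z \<mapsto> vac u * z\<close> respects the relations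
  of the tensor product, the balancing relation by \<open>vac_toroidal_borel\<close>. In particular \<open>v\<^sub>\<lambda> \<noteq> 0\<close>.\<close>

lemma vac_toroidal_cong:
  assumes l: "l \<in> dual_space cartan" and eq: "verma_class l u = verma_class l v"
  shows "vac_toroidal l u = vac_toroidal l v"
proof -
  define F where "F = pm_extend (\<lambda>(u, z) k. of_int k * (vac_toroidal l u * z))"
  have F_add: "F (c + d) = F c + F d" for c d
    unfolding F_def by (rule pm_extend_add) (auto simp: algebra_simps)
  have F_of: "F (frag_of (u, z)) = vac_toroidal l u * z" for u z
    unfolding F_def by (subst pm_extend_single) auto
  have F_zero: "F 0 = 0" using F_add[of 0 0] by simp
  have F_minus: "F (- c) = - F c" for c
    using F_add[of c "- c"] F_zero by (simp add: eq_neg_iff_add_eq_0 add.commute)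
  have F_diff: "F (c - d) = F c - F d" for c d
    using F_add[of c "- d"] F_minus by simp
  have rels: "F r = 0" if "r \<in> tensor_rels verma_right (verma_left l)" for r
    using that unfolding tensor_rels_def
    by (auto simp: F_diff F_of vac_toroidal(2)[OF l] distrib_left distrib_right verma_right_def
        verma_left_def vac_toroidal_borel[OF l])
  have "F r = 0" if "r \<in> tensor_null verma_right (verma_left l)" for r
    using that unfolding tensor_null_def
    by induction (simp_all add: F_zero F_minus F_add rels)
  then have "F (frag_of (u, 1) - frag_of (v, 1)) = 0"
    using eq unfolding verma_class_def pure_tensor_eq_iff by blast
  then show ?thesis
    by (simp add: F_diff F_of)
qed

text \<open>Stability of \<open>U\<close> under multiplication is only asked for modulo the annihilator of \<open>v\<^sub>\<lambda>\<close>, since the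
  sets to which this is applied are stable only in that sense.\<close>

lemma verma_submodule:
  assumes l: "l \<in> dual_space cartan" and "U \<noteq> {}"
    and add: "\<And>u v. u \<in> U \<Longrightarrow> v \<in> U \<Longrightarrow> u + v \<in> U"
    and smult: "\<And>a u. u \<in> U \<Longrightarrow> verma_class l (a * u) \<in> verma_class l ` U"
  shows "submodule (verma_class l ` U) uea_ring (verma l)"
proof (intro submodule.intro submodule_axioms.intro group.subgroupI[OF group_verma])
  show "verma_class l ` U \<subseteq> carrier (add_monoid (verma l))"
    by (auto simp: carrier_verma[OF l])
  show "verma_class l ` U \<noteq> {}"
    using assms by simp
  fix a b assume a: "a \<in> verma_class l ` U"
  then obtain u where u: "u \<in> U" "a = verma_class l u" by blast
  show "b \<in> verma_class l ` U \<Longrightarrow> a \<otimes>\<^bsub>add_monoid (verma l)\<^esub> b \<in> verma_class l ` U"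
    using u add by (auto simp: add_verma_class)
  interpret G: group "add_monoid (verma l)" by (rule group_verma)
  have cl: "verma_class l v \<in> carrier (add_monoid (verma l))" for v
    by (simp add: carrier_verma[OF l])
  have "verma_class l 0 \<otimes>\<^bsub>add_monoid (verma l)\<^esub> verma_class l 0 = verma_class l 0"
    by (simp add: add_verma_class)
  then have one: "\<one>\<^bsub>add_monoid (verma l)\<^esub> = verma_class l 0"
    using G.l_cancel_one[OF cl cl] by blast
  have "verma_class l (- 1 * u) \<otimes>\<^bsub>add_monoid (verma l)\<^esub> verma_class l u = verma_class l 0"
    by (simp add: add_verma_class)
  then have "inv\<^bsub>add_monoid (verma l)\<^esub> a = verma_class l (- 1 * u)"
    unfolding u one[symmetric] by (rule G.inv_equality) (rule cl)+
  then show "inv\<^bsub>add_monoid (verma l)\<^esub> a \<in> verma_class l ` U"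
    using smult[OF u(1), of "- 1"] by simp
next
  fix a x assume "x \<in> verma_class l ` U"
  then show "a \<odot>\<^bsub>verma l\<^esub> x \<in> verma_class l ` U"
    using smult by (auto simp: smult_verma_class)
qed

definition verma_annihilator :: "(toroidal \<Rightarrow> complex) \<Rightarrow> toroidal uea set" where
  "verma_annihilator l = {u. verma_class l u = verma_class l 0}"

lemma left_ideal_verma_annihilator: "left_ideal (verma_annihilator l)"
  unfolding left_ideal_def verma_annihilator_def
  using add_verma_class[of l] smult_verma_class[of l]
  by (metis (mono_tags, lifting) add.right_neutral mem_Collect_eq mult_zero_right)

lemma verma_class_cong: "u - v \<in> verma_annihilator l \<Longrightarrow> verma_class l u = verma_class l v"
  using add_verma_class[of l "u - v" v] add_verma_class[of l 0 v]
  by (simp add: verma_annihilator_def)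

lemma verma_annihilator_borel:
  assumes "l \<in> dual_space cartan" "x \<in> borel_part"
  shows "uea_gen x - l (cartan_proj x) *\<^sub>C 1 \<in> verma_annihilator l"
  using add_verma_class[of l "uea_gen x" "- (l (cartan_proj x) *\<^sub>C 1)"]
    add_verma_class[of l "l (cartan_proj x) *\<^sub>C 1" "- (l (cartan_proj x) *\<^sub>C 1)"]
  by (simp add: verma_annihilator_def verma_class_borel[OF assms])

section \<open>Singular vectors and the submodules that they generate\<close>

text \<open>If \<open>s v\<close> is a common eigenvector of \<open>\<TT>\<^sub>+ \<oplus> \<hh>\<close>, then \<open>U(\<TT>) s v = U(\<TT>\<^sub>-) s v\<close>. This is the spanning
  half of \<open>U(\<TT>) = U(\<TT>\<^sub>-) U(\<TT>\<^sub>+ \<oplus> \<hh>)\<close>: an element \<open>x\<close> of \<open>\<TT>\<^sub>+ \<oplus> \<hh>\<close> is moved to the right past one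
  factor \<open>y \<in> \<TT>\<^sub>-\<close> at a time, and both components of \<open>[x, y]\<close> act on a product with one factor less.\<close>

lemma minus_orbit_stable_mod_left_ideal:
  assumes J: "left_ideal J" and eig: "\<And>x. x \<in> borel_part \<Longrightarrow> \<exists>c. uea_gen x * s - c *\<^sub>C s \<in> J"
  shows "\<exists>v. a * (minus_incl u * s) - minus_incl v * s \<in> J"
proof -
  \<comment> \<open>the elements that act on the highest weight vector like an element of \<open>U(\<TT>\<^sub>-) s\<close>\<close>
  define W where "W = {w. \<exists>v. w - minus_incl v * s \<in> J}"
  note closed = left_ideal_closed[OF J]
  have W_add: "w + w' \<in> W" if w: "w \<in> W" "w' \<in> W" for w w'
  proof -
    obtain v v' where "w - minus_incl v * s \<in> J" "w' - minus_incl v' * s \<in> J"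
      using w unfolding W_def by blast
    then have "(w - minus_incl v * s) + (w' - minus_incl v' * s) \<in> J"
      by (rule closed(2))
    then show ?thesis
      unfolding W_def by (intro CollectI exI[of _ "v + v'"]) (simp add: minus_incl_hom algebra_simps)
  qed
  have W_scaleC: "c *\<^sub>C w \<in> W" if w: "w \<in> W" for c w
  proof -
    obtain v where "w - minus_incl v * s \<in> J"
      using w unfolding W_def by blast
    then have "c *\<^sub>C (w - minus_incl v * s) \<in> J"
      by (rule left_ideal_scaleC[OF J])
    then show ?thesis
      unfolding W_def by (intro CollectI exI[of _ "c *\<^sub>C v"])
        (simp add: minus_incl_hom mult_scaleC_left complex_vector.scale_right_diff_distrib)
  qed
  have W_base: "minus_incl v * s \<in> W" for v
    unfolding W_def using closed(1) by (intro CollectI exI[of _ v]) simp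
  have W_J: "w \<in> W" if w: "w - w' \<in> J" "w' \<in> W" for w w'
  proof -
    obtain v where "w' - minus_incl v * s \<in> J"
      using w(2) unfolding W_def by blast
    from closed(2)[OF w(1) this] show ?thesis
      unfolding W_def by (intro CollectI exI[of _ v]) simp
  qed
  have W_minus: "uea_gen z * w \<in> W" if "z \<in> negative_part" and w: "w \<in> W" for z w
  proof -
    obtain v where "w - minus_incl v * s \<in> J"
      using w unfolding W_def by blast
    then have "uea_gen z * (w - minus_incl v * s) \<in> J"
      by (rule closed(3))
    then show ?thesis
      unfolding W_def by (intro CollectI exI[of _ "uea_gen (Abs_tor_minus z) * v"])
        (simp add: minus_incl_hom Abs_tor_minus_inverse that algebra_simps)
  qed
  have W_split: "uea_gen z * w \<in> W"
    if "w \<in> W" "\<And>x. x \<in> borel_part \<Longrightarrow> uea_gen x * w \<in> W" for z w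
  proof -
    have "uea_gen z * w = uea_gen (neg_proj z) * w + uea_gen (z - neg_proj z) * w"
      unfolding distrib_right[symmetric] uea_gen_linear(1)[symmetric] by simp
    then show ?thesis
      using W_add[OF W_minus[OF neg_proj_in that(1)] that(2)[OF sub_neg_proj_borel]] by simp
  qed
  have W_borel: "uea_gen x * (minus_incl v * s) \<in> W" if "x \<in> borel_part" for x v
    using that
  proof (induction v arbitrary: x rule: uea_left_induct)
    case one
    obtain c where "uea_gen x * s - c *\<^sub>C s \<in> J"
      using eig[OF one] by blast
    then show ?case
      using W_J W_scaleC[OF W_base[of 1]] by (simp add: minus_incl_hom)
  next
    case (add u v)
    then show ?case
      using W_add by (simp add: minus_incl_hom distrib_left distrib_right)
  next
    case (scaleC c v)
    then show ?case
      using W_scaleC by (simp add: minus_incl_hom mult_scaleC_left mult_scaleC_right)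
  next
    case (mult_gen y v)
    define w where "w = minus_incl v * s"
    let ?y = "Rep_tor_minus y"
    have "uea_gen x * (minus_incl (uea_gen y * v) * s) = uea_gen ?y * (uea_gen x * w) + uea_gen (lie x ?y) * w"
      by (simp add: w_def minus_incl_hom uea_gen_linear algebra_simps)
    moreover have "uea_gen ?y * (uea_gen x * w) \<in> W"
      unfolding w_def by (rule W_minus[OF Rep_tor_minus mult_gen.IH[OF mult_gen.prems]])
    moreover have "uea_gen (lie x ?y) * w \<in> W"
      unfolding w_def by (rule W_split[OF W_base mult_gen.IH])
    ultimately show ?case
      using W_add by simp
  qed
  have W_gen: "uea_gen x * w \<in> W" if w: "w \<in> W" for x w
  proof -
    obtain v where "w - minus_incl v * s \<in> J"
      using w unfolding W_def by blast
    then have "uea_gen x * w - uea_gen x * (minus_incl v * s) \<in> J"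
      unfolding right_diff_distrib[symmetric] by (rule closed(3))
    then show ?thesis
      by (rule W_J) (rule W_split[OF W_base W_borel])
  qed
  have "a * w \<in> W" if "w \<in> W" for w
    by (induction a rule: uea_left_induct)
      (use that W_add W_scaleC W_gen in \<open>simp_all add: distrib_right mult_scaleC_left mult.assoc\<close>)
  then have "a * (minus_incl u * s) \<in> W"
    using W_base by blast
  then show ?thesis
    unfolding W_def by blast
qed

lemma borel_eigenvectorI:
  assumes J: "left_ideal J"
    and pos: "\<And>m. m \<ge> 0 \<Longrightarrow> uea_gen (loop_el sl2_e m 0) * s \<in> J"
      "\<And>m. m \<ge> 1 \<Longrightarrow> uea_gen (loop_el sl2_f m 0) * s \<in> J"
      "\<And>m. m \<ge> 1 \<Longrightarrow> uea_gen (loop_el sl2_h m 0) * s \<in> J"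
      "\<And>x m n. n \<ge> 1 \<Longrightarrow> uea_gen (loop_el x m n) * s \<in> J"
    and cartan: "\<And>h. h \<in> {loop_el sl2_h 0 0, tor_c1, tor_c2, tor_d1, tor_d2} \<Longrightarrow>
      \<exists>c. uea_gen h * s - c *\<^sub>C s \<in> J"
    and x: "x \<in> borel_part"
  shows "\<exists>c. uea_gen x * s - c *\<^sub>C s \<in> J"
proof -
  define P where "P = {x. \<exists>c. uea_gen x * s - c *\<^sub>C s \<in> J}"
  note closed = left_ideal_closed[OF J]
  have add: "x + y \<in> P" if xy: "x \<in> P" "y \<in> P" for x y
  proof -
    obtain c d where "uea_gen x * s - c *\<^sub>C s \<in> J" "uea_gen y * s - d *\<^sub>C s \<in> J"
      using xy unfolding P_def by blast
    from closed(2)[OF this] show ?thesis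
      unfolding P_def by (intro CollectI exI[of _ "c + d"]) (simp add: uea_gen_linear scaleC_add_left algebra_simps)
  qed
  have scale: "a *\<^sub>C x \<in> P" if x: "x \<in> P" for a x
  proof -
    obtain c where "uea_gen x * s - c *\<^sub>C s \<in> J"
      using x unfolding P_def by blast
    from left_ideal_scaleC[OF J this, of a] show ?thesis
      unfolding P_def by (intro CollectI exI[of _ "a * c"])
        (simp add: uea_gen_linear mult_scaleC_left scaleC_scaleC complex_vector.scale_right_diff_distrib)
  qed
  have zero: "x \<in> P" if "uea_gen x * s \<in> J" for x
    unfolding P_def using that by (intro CollectI exI[of _ 0]) simp
  have sub: "complex_vector.subspace P"
    unfolding complex_vector.subspace_def
    using add scale scale[of "loop_el sl2_e 0 0" 0] zero[OF pos(1)] by simp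
  have "positive_part \<subseteq> P"
    unfolding positive_part_def by (rule complex_vector.span_minimal[OF _ sub]) (use zero pos in blast)
  moreover have "cartan \<subseteq> P"
    unfolding cartan_def by (rule complex_vector.span_minimal[OF _ sub]) (use cartan in \<open>auto simp: P_def\<close>)
  ultimately have "x \<in> P"
    using x add unfolding borel_part_def by blast
  then show ?thesis
    unfolding P_def by blast
qed

lemma loop_el_scaleC: "loop_el (s *\<^sub>C x) m n = s *\<^sub>C loop_el x m n"
  by (simp add: loop_el_def toroidal_defs)

lemma loop_el_uminus: "loop_el (- x) m n = - loop_el x m n"
  using loop_el_scaleC[of "- 1" x m n] by simp

lemma cartan_brackets:
  "lie (loop_el sl2_h 0 0) y0 = 2 *\<^sub>C y0" "lie tor_c1 y0 = 0 *\<^sub>C y0" "lie tor_c2 y0 = 0 *\<^sub>C y0"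
  "lie tor_d1 y0 = (- 1) *\<^sub>C y0" "lie tor_d2 y0 = 0 *\<^sub>C y0"
  "lie (loop_el sl2_h 0 0) y1 = (- 2) *\<^sub>C y1" "lie tor_c1 y1 = 0 *\<^sub>C y1" "lie tor_c2 y1 = 0 *\<^sub>C y1"
  "lie tor_d1 y1 = 0 *\<^sub>C y1" "lie tor_d2 y1 = 0 *\<^sub>C y1"
  by (simp_all add: y0_def y1_def toroidal_brackets sl2_brackets loop_el_scaleC loop_el_uminus)

lemma loop_el_positive:
  "m \<ge> 0 \<Longrightarrow> loop_el sl2_e m 0 \<in> positive_part"
  "m \<ge> 1 \<Longrightarrow> loop_el x m 0 \<in> positive_part"
  by (auto simp: positive_part_iff loop_el_def lookup_single when_def sl2_e_def)

text \<open>The elements \<open>x(m, n)\<close> with \<open>n \<ge> 1\<close>, or \<open>n = 0\<close> and \<open>m \<ge> 1\<close>, kill the highest weight vector and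
  form a set that is stable under \<open>ad f\<close>, because \<open>f = f(0, 0)\<close> preserves the degree; central terms
  occur only in degree \<open>(0, 0)\<close>. Of the spanning set of \<open>\<TT>\<^sub>+\<close> this leaves only \<open>e(0, 0)\<close>, the partner of \<open>f\<close> in an
  \<open>sl\<^sub>2\<close>-triple.\<close>

lemma singular_y1:
  assumes J: "left_ideal J" and pos: "\<And>x. x \<in> positive_part \<Longrightarrow> uea_gen x \<in> J"
    and cartan: "\<And>h. h \<in> cartan \<Longrightarrow> uea_gen h - l h *\<^sub>C 1 \<in> J"
    and n: "l coroot1 = of_nat n" and x: "x \<in> borel_part"
  shows "\<exists>c. uea_gen x * uea_gen y1 ^ Suc n - c *\<^sub>C uea_gen y1 ^ Suc n \<in> J"
proof (rule borel_eigenvectorI[OF J _ _ _ _ _ x])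
  define A where "A = {loop_el x m k |x m k. k \<ge> 1 \<or> k = 0 \<and> m \<ge> 1}"
  have A: "uea_gen x * uea_gen y1 ^ Suc n \<in> J" if "x \<in> A" for x
  proof (rule mult_power_in_left_ideal[OF J _ _ that])
    fix x assume "x \<in> A"
    then show "uea_gen x \<in> J"
      unfolding A_def by (auto intro!: pos simp: positive_part_iff loop_el_def lookup_single when_def)
    show "lie x y1 \<in> A"
    proof -
      obtain z m k where x: "x = loop_el z m k" and *: "k \<ge> 1 \<or> k = 0 \<and> m \<ge> 1"
        using \<open>x \<in> A\<close> unfolding A_def by blast
      have "lie x y1 = loop_el (lie z sl2_f) m k"
        using * by (auto simp: x y1_def toroidal_brackets)
      then show ?thesis
        using * unfolding A_def by blast
    qed
  qed
  have e: "uea_gen (loop_el sl2_e 0 0) * uea_gen y1 ^ Suc n \<in> J"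
  proof -
    have "coroot1 \<in> cartan"
      unfolding coroot1_def cartan_def by (rule complex_vector.span_base) simp
    moreover have "lie (loop_el sl2_e 0 0) y1 = coroot1"
      by (simp add: y1_def toroidal_brackets sl2_brackets coroot1_def)
    ultimately show ?thesis
      using sl2_triple_mod_left_ideal[OF J pos[OF loop_el_positive(1)] cartan[of coroot1], of 0 y1 n]
        n cartan_brackets(6)
      by (simp add: coroot1_def)
  qed
  have A_loop: "uea_gen (loop_el z m k) * uea_gen y1 ^ Suc n \<in> J"
    if "k \<ge> 1 \<or> k = 0 \<and> m \<ge> 1" for z m k
    by (rule A) (use that in \<open>unfold A_def, blast\<close>)
  show "uea_gen (loop_el sl2_e m 0) * uea_gen y1 ^ Suc n \<in> J" if "m \<ge> 0" for m
  proof (cases "m = 0")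
    case False
    then show ?thesis
      using that by (intro A_loop) auto
  qed (use e in simp)
  show "uea_gen (loop_el sl2_f m 0) * uea_gen y1 ^ Suc n \<in> J"
    "uea_gen (loop_el sl2_h m 0) * uea_gen y1 ^ Suc n \<in> J" if "m \<ge> 1" for m
    using that by (auto intro!: A_loop simp del: power_Suc)
  show "uea_gen (loop_el x m k) * uea_gen y1 ^ Suc n \<in> J" if "k \<ge> 1" for x m k
    using that by (intro A_loop) simp
  fix h assume h: "h \<in> {loop_el sl2_h 0 0, tor_c1, tor_c2, tor_d1, tor_d2}"
  then have "h \<in> cartan"
    unfolding cartan_def by (rule complex_vector.span_base)
  moreover obtain c where "lie h y1 = c *\<^sub>C y1"
    using h cartan_brackets by blast
  ultimately show "\<exists>c. uea_gen h * uea_gen y1 ^ Suc n - c *\<^sub>C uea_gen y1 ^ Suc n \<in> J"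
    using weight_power_mod_left_ideal[OF J cartan] by blast
qed

text \<open>The analogue for the other simple root. Now \<open>y\<^sub>0 = e(-1, 0)\<close> lowers the first degree by \<open>1\<close>, so the
  set of annihilating elements has to be cut down to be stable under \<open>ad y\<^sub>0\<close>: in degrees \<open>(m, 0)\<close> it contains
  all \<open>x\<close> for \<open>m \<ge> 2\<close>, the span of \<open>e\<close> and \<open>\<alpha>\<^sup>\<or>\<close> for \<open>m = 1\<close>, the span of \<open>e\<close> for \<open>m = 0\<close>,
  and \<open>0\<close>. Of the spanning set of \<open>\<TT>\<^sub>+\<close> this leaves only
  \<open>f(1, 0)\<close>, and \<open>[f(1, 0), e(-1, 0)] = c\<^sub>1 - \<alpha>\<^sup>\<or>\<close> is the coroot of \<open>y\<^sub>0\<close>.\<close>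

lemma singular_y0:
  assumes J: "left_ideal J" and pos: "\<And>x. x \<in> positive_part \<Longrightarrow> uea_gen x \<in> J"
    and cartan: "\<And>h. h \<in> cartan \<Longrightarrow> uea_gen h - l h *\<^sub>C 1 \<in> J"
    and n: "l coroot0 = of_nat n" and x: "x \<in> borel_part"
  shows "\<exists>c. uea_gen x * uea_gen y0 ^ Suc n - c *\<^sub>C uea_gen y0 ^ Suc n \<in> J"
proof (rule borel_eigenvectorI[OF J _ _ _ _ _ x])
  define A where "A = {loop_el x m k |x m k. k \<ge> 1 \<or> k = 0 \<and> (m \<ge> 2 \<or> m = 1 \<and> f_coeff x = 0
      \<or> m = 0 \<and> f_coeff x = 0 \<and> h_coeff x = 0 \<or> x = 0)}"
  have A: "uea_gen x * uea_gen y0 ^ Suc n \<in> J" if "x \<in> A" for x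
  proof (rule mult_power_in_left_ideal[OF J _ _ that])
    fix x assume "x \<in> A"
    then show "uea_gen x \<in> J"
      unfolding A_def
      by (auto intro!: pos simp: positive_part_iff loop_el_def lookup_single when_def)
    obtain z m k where x: "x = loop_el z m k" and *: "k \<ge> 1 \<or> k = 0 \<and> (m \<ge> 2 \<or> m = 1 \<and> f_coeff z = 0
      \<or> m = 0 \<and> f_coeff z = 0 \<and> h_coeff z = 0 \<or> z = 0)"
      using \<open>x \<in> A\<close> unfolding A_def by blast
    \<comment> \<open>a central term would need \<open>m = 1\<close> and \<open>k = 0\<close>, where \<open>(z|e)\<close> is the coefficient of \<open>f\<close> in \<open>z\<close>\<close>
    have "lie x y0 = loop_el (lie z sl2_e) (m - 1) k"
      using * by (auto simp: x y0_def toroidal_brackets sl2_form_def sl2_e_def)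
    moreover have "k \<ge> 1 \<or> k = 0 \<and> (m - 1 \<ge> 2 \<or> m - 1 = 1 \<and> f_coeff (lie z sl2_e) = 0
      \<or> m - 1 = 0 \<and> f_coeff (lie z sl2_e) = 0 \<and> h_coeff (lie z sl2_e) = 0 \<or> lie z sl2_e = 0)"
      using * by (auto simp: lie_sl2_def sl2_e_def zero_sl2_def)
    ultimately show "lie x y0 \<in> A"
      unfolding A_def by blast
  qed
  have f: "uea_gen (loop_el sl2_f 1 0) * uea_gen y0 ^ Suc n \<in> J"
  proof -
    have "coroot0 \<in> cartan"
      unfolding coroot0_def cartan_def by (intro complex_vector.span_diff complex_vector.span_base) simp_all
    moreover have "lie (loop_el sl2_f 1 0) y0 = coroot0"
    proof -
      have "lie sl2_f sl2_e = (- 1) *\<^sub>C sl2_h"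
        using lie_skew[of sl2_f sl2_e] by (simp add: sl2_brackets)
      moreover have "sl2_form sl2_f sl2_e = 1"
        by (simp add: sl2_form_sym sl2_form_values)
      ultimately show ?thesis
        by (simp only: y0_def toroidal_brackets coroot0_def) (simp add: loop_el_scaleC loop_el_uminus scaleC_one)
    qed
    moreover have "lie coroot0 y0 = (- 2) *\<^sub>C y0"
      using cartan_brackets(1,2) by (simp add: coroot0_def lie_diff)
    ultimately show ?thesis
      using sl2_triple_mod_left_ideal[OF J pos[OF loop_el_positive(2)] cartan[of coroot0], of 1 sl2_f y0 n] n
      by simp
  qed
  have A_loop: "uea_gen (loop_el z m k) * uea_gen y0 ^ Suc n \<in> J"
    if "k \<ge> 1 \<or> k = 0 \<and> (m \<ge> 2 \<or> m = 1 \<and> f_coeff z = 0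
      \<or> m = 0 \<and> f_coeff z = 0 \<and> h_coeff z = 0 \<or> z = 0)" for z m k
    by (rule A) (use that in \<open>unfold A_def, blast\<close>)
  show "uea_gen (loop_el sl2_e m 0) * uea_gen y0 ^ Suc n \<in> J" if "m \<ge> 0" for m
    using that by (intro A_loop) (auto simp: sl2_e_def)
  show "uea_gen (loop_el sl2_f m 0) * uea_gen y0 ^ Suc n \<in> J" if "m \<ge> 1" for m
  proof (cases "m = 1")
    case False
    then show ?thesis
      using that by (intro A_loop) auto
  qed (use f in simp)
  show "uea_gen (loop_el sl2_h m 0) * uea_gen y0 ^ Suc n \<in> J" if "m \<ge> 1" for m
    using that by (intro A_loop) (auto simp: sl2_h_def)
  show "uea_gen (loop_el x m k) * uea_gen y0 ^ Suc n \<in> J" if "k \<ge> 1" for x m k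
    using that by (intro A_loop) simp
  fix h assume h: "h \<in> {loop_el sl2_h 0 0, tor_c1, tor_c2, tor_d1, tor_d2}"
  then have "h \<in> cartan"
    unfolding cartan_def by (rule complex_vector.span_base)
  moreover obtain c where "lie h y0 = c *\<^sub>C y0"
    using h cartan_brackets by blast
  ultimately show "\<exists>c. uea_gen h * uea_gen y0 ^ Suc n - c *\<^sub>C uea_gen y0 ^ Suc n \<in> J"
    using weight_power_mod_left_ideal[OF J cartan] by blast
qed

lemma minus_orbit_class:
  "minus_orbit l (a \<odot>\<^bsub>verma l\<^esub> verma_vector l) = range (\<lambda>u. verma_class l (minus_incl u * a))"
  by (auto simp: minus_orbit_def verma_vector_class smult_verma_class)

theorem proposition3p2:
  fixes l :: "toroidal \<Rightarrow> complex" and k1 :: real and n0 n1 :: nat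
  assumes "l \<in> dual_space cartan"
    and "l tor_c1 = complex_of_real k1" and "k1 \<ge> 0"
    and "l tor_c2 = 0"
    and "l coroot0 = of_nat n0"
    and "l coroot1 = of_nat n1"
  shows "proper_submodule
    (minus_orbit l (uea_gen y0 ^ (n0 + 1) \<odot>\<^bsub>verma l\<^esub> verma_vector l) <+>\<^bsub>verma l\<^esub>
     minus_orbit l (uea_gen y1 ^ (n1 + 1) \<odot>\<^bsub>verma l\<^esub> verma_vector l))
    uea_ring (verma l)"
proof -
  note l = assms(1)
  let ?J = "verma_annihilator l"
  define s0 where "s0 = uea_gen y0 ^ Suc n0"
  define s1 where "s1 = uea_gen y1 ^ Suc n1"
  define U where "U = {minus_incl u * s0 + minus_incl v * s1 |u v. True}"
  let ?H = "minus_orbit l (uea_gen y0 ^ (n0 + 1) \<odot>\<^bsub>verma l\<^esub> verma_vector l) <+>\<^bsub>verma l\<^esub>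
     minus_orbit l (uea_gen y1 ^ (n1 + 1) \<odot>\<^bsub>verma l\<^esub> verma_vector l)"
  \<comment> \<open>\<open>U\<close> itself need not be a left ideal of \<open>U(\<TT>)\<close>, but its image in the Verma module is a submodule\<close>
  have H: "?H = verma_class l ` U"
    unfolding set_add_def' minus_orbit_class U_def Suc_eq_plus1[symmetric]
      s0_def[symmetric] s1_def[symmetric]
    by (auto simp: add_verma_class)
  note J = left_ideal_verma_annihilator[of l]
  have l0: "l 0 = 0"
    using polarized_character.\<chi>_range[OF polarized_character_toroidal[OF l], of 0]
    by (simp add: cartan_proj_negative[OF neg_proj_in])
  have pos: "uea_gen x \<in> ?J" if "x \<in> positive_part" for x
  proof -
    have "x \<in> borel_part"
      using that complex_vector.span_zero unfolding borel_part_def cartan_def by force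
    then show ?thesis
      using verma_annihilator_borel[OF l, of x] by (simp add: cartan_proj_positive that l0)
  qed
  have cartan: "uea_gen h - l h *\<^sub>C 1 \<in> ?J" if "h \<in> cartan" for h
  proof -
    have "h \<in> borel_part"
      using that complex_vector.span_zero unfolding borel_part_def positive_part_def by force
    then show ?thesis
      using verma_annihilator_borel[OF l, of h] by (simp add: cartan_proj_cartan that)
  qed
  have stable: "\<exists>v. a * (minus_incl u * s) - minus_incl v * s \<in> ?J" if "s = s0 \<or> s = s1" for a u s
    using that minus_orbit_stable_mod_left_ideal[OF J singular_y0[OF J pos cartan assms(5)]]
      minus_orbit_stable_mod_left_ideal[OF J singular_y1[OF J pos cartan assms(6)]]
    unfolding s0_def s1_def by blast
  have "submodule ?H uea_ring (verma l)"
    unfolding H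
  proof (rule verma_submodule[OF l])
    show "U \<noteq> {}" unfolding U_def by blast
    fix u assume u: "u \<in> U"
    then obtain a b where ab: "u = minus_incl a * s0 + minus_incl b * s1"
      unfolding U_def by blast
    show "u + v \<in> U" if v: "v \<in> U" for v
    proof -
      obtain c d where "v = minus_incl c * s0 + minus_incl d * s1"
        using v unfolding U_def by blast
      then have "u + v = minus_incl (a + c) * s0 + minus_incl (b + d) * s1"
        by (simp add: ab minus_incl_hom algebra_simps)
      then show ?thesis unfolding U_def by blast
    qed
    fix x
    obtain c where c: "x * (minus_incl a * s0) - minus_incl c * s0 \<in> ?J"
      using stable[of s0 x a] by blast
    obtain d where d: "x * (minus_incl b * s1) - minus_incl d * s1 \<in> ?J"
      using stable[of s1 x b] by blast
    from left_ideal_closed(2)[OF J c d]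
    have "x * u - (minus_incl c * s0 + minus_incl d * s1) \<in> ?J"
      by (simp add: ab algebra_simps)
    then have "verma_class l (x * u) = verma_class l (minus_incl c * s0 + minus_incl d * s1)"
      by (rule verma_class_cong)
    then show "verma_class l (x * u) \<in> verma_class l ` U"
      unfolding U_def by blast
  qed
  moreover have "verma_vector l \<notin> ?H"
  proof
    assume "verma_vector l \<in> ?H"
    then have "verma_vector l \<in> verma_class l ` U"
      by (simp only: H)
    then obtain u v where "verma_class l 1 = verma_class l (minus_incl u * s0 + minus_incl v * s1)"
      unfolding verma_vector_class U_def by blast
    then have "vac_toroidal l 1 = vac_toroidal l (minus_incl u * s0 + minus_incl v * s1)"
      by (rule vac_toroidal_cong[OF l])
    moreover have "y0 \<in> negative_part" "y1 \<in> negative_part"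
      by (auto simp: y0_def y1_def negative_part_iff loop_el_def lookup_single when_def sl2_f_def)
    ultimately show False
      by (simp add: vac_toroidal[OF l] vac_toroidal_minus[OF l] s0_def s1_def del: power_Suc)
  qed
  moreover have "verma_vector l \<in> carrier (verma l)"
    by (simp add: carrier_verma[OF l] verma_vector_class)
  ultimately show ?thesis
    unfolding proper_submodule_def by blast
qed

end
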